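(* Let $\ell\ge3$ and $0\le i<\ell$. Regularization commutes with the crystal operators: as maps on the nodes of $B(\Lambda_0)^L$ (with the convention $\mathcal R(0)=0$), 1. $\mathcal R\circ\widehat f_i=\widetilde f_i\circ\mathcal R$; 2. $\mathcal R\circ\widehat e_i=\widetilde e_i\circ\mathcal R$.
   Context: The position $(a,b)$ (row $a$, rows numbered downward; column $b$) has residue $b-a\bmod\ell$. The ladder of $(a,b)$ is the set of positions $(c,d)$, $c,d\ge1$, with $c-a=(\ell-1)(b-d)$; all its positions have the same residue, and it is an $i$-ladder if that residue is $i$. Ladders are ordered left to right, i.e. by increasing value of $a+(\ell-1)(b-1)$. The regularization $\mathcal R\lambda$ of a partition $\lambda$ is the ($\ell$-regular) partition obtained by moving all boxes of $\lambda$ up to the top of their respective ladders. A partition is $\ell$-regular if it does not have $\ell$ or more equal nonzero parts. A box of $\lambda$ of residue $i$ whose removal leaves a partition is a removable $i$-box (marked $-$); a position of residue $i$ not in $\lambda$ whose addition gives a partition is an addable $i$-box (marked $+$). Classical crystal $B(\Lambda_0)$ on $\ell$-regular partitions: the $i$-signature is the word of $+$'s and $-$'s read from the bottom row to the top row; after repeatedly deleting adjacent pairs $-+$ one gets $+\cdots+-\cdots-$. $\widetilde f_i\lambda$ adds the box of the rightmost remaining $+$ and $\widetilde e_i\lambda$ removes the box of the leftmost remaining $-$ (the result is $0$ if there is no such sign). Ladder crystal: the ladder $i$-signature of a partition is the word of $+$'s and $-$'s read from leftmost to rightmost $i$-ladder, and from top to bottom on each ladder; again repeatedly delete adjacent pairs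 $-+$. $\widehat f_i\lambda$ adds the box of the rightmost remaining $+$ and $\widehat e_i\lambda$ removes the box of the leftmost remaining $-$ (the result is $0$ if there is no such sign). The nodes of $B(\Lambda_0)^L$ are the partitions obtained from the empty partition $\emptyset$ by applying finite sequences of the operators $\widehat f_i$, $0\le i<\ell$. *)

theory Defs
  imports Main "HOL-Library.Product_Lexorder"
begin

(* A partition is identified with its Young diagram, a set of positions (row, column), both
   numbered from 1, rows downward. *)

type_synonym pos = "nat \<times> nat"
type_synonym diagram = "pos set"

definition is_pos :: "pos \<Rightarrow> bool" where
  "is_pos p \<longleftrightarrow> 1 \<le> fst p \<and> 1 \<le> snd p"

definition is_partition :: "diagram \<Rightarrow> bool" where
  "is_partition D \<longleftrightarrow> finite D \<and> (\<forall>p\<in>D. is_pos p) \<and>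
     (\<forall>a b c d. (a, b) \<in> D \<and> 1 \<le> c \<and> c \<le> a \<and> 1 \<le> d \<and> d \<le> b \<longrightarrow> (c, d) \<in> D)"

definition residue :: "nat \<Rightarrow> pos \<Rightarrow> int" where
  "residue l p = (int (snd p) - int (fst p)) mod int l"

definition ladder :: "nat \<Rightarrow> pos \<Rightarrow> pos set" where
  "ladder l p = {q. is_pos q \<and>
     int (fst q) - int (fst p) = (int l - 1) * (int (snd p) - int (snd q))}"

(* Constant on ladders and increasing from left to right; the truncated subtractions are
   harmless, since it is only used for l \<ge> 1 and columns \<ge> 1. *)
definition ladder_index :: "nat \<Rightarrow> pos \<Rightarrow> nat" where
  "ladder_index l p = fst p + (l - 1) * (snd p - 1)"

(* A ladder (finite for l \<ge> 2) has at most one position in each row.  If D has k boxes on it,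
   they are moved to its k highest positions, that is, to those with fewer than k positions of
   the ladder above them. *)
definition regularization :: "nat \<Rightarrow> diagram \<Rightarrow> diagram" where
  "regularization l D = {p. is_pos p \<and>
     card {q \<in> ladder l p. fst q < fst p} < card (D \<inter> ladder l p)}"

definition addable :: "nat \<Rightarrow> nat \<Rightarrow> diagram \<Rightarrow> pos \<Rightarrow> bool" where
  "addable l i D p \<longleftrightarrow> p \<notin> D \<and> residue l p = int i \<and> is_partition (insert p D)"

definition removable :: "nat \<Rightarrow> nat \<Rightarrow> diagram \<Rightarrow> pos \<Rightarrow> bool" where
  "removable l i D p \<longleftrightarrow> p \<in> D \<and> residue l p = int i \<and> is_partition (D - {p})"

datatype sign = Plus | Minus

definition signed_boxes :: "nat \<Rightarrow> nat \<Rightarrow> diagram \<Rightarrow> (sign \<times> pos) set" where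
  "signed_boxes l i D = Pair Plus ` {p. addable l i D p} \<union> Pair Minus ` {p. removable l i D p}"

(* Bottom row to top row.  For l \<ge> 2 a row of a partition carries at most one sign of a given
   residue, so the key is injective on the signed boxes. *)
definition signature :: "nat \<Rightarrow> nat \<Rightarrow> diagram \<Rightarrow> (sign \<times> pos) list" where
  "signature l i D = sorted_key_list_of_set (\<lambda>x. - int (fst (snd x))) (signed_boxes l i D)"

(* The keys are ordered lexicographically: ladders from left to right, then from top to bottom. *)
definition ladder_signature :: "nat \<Rightarrow> nat \<Rightarrow> diagram \<Rightarrow> (sign \<times> pos) list" where
  "ladder_signature l i D =
     sorted_key_list_of_set (\<lambda>x. (ladder_index l (snd x), fst (snd x))) (signed_boxes l i D)"

inductive cancel :: "(sign \<times> 'a) list \<Rightarrow> (sign \<times> 'a) list \<Rightarrow> bool" where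
  "cancel (xs @ [(Minus, p), (Plus, q)] @ ys) (xs @ ys)"

definition reduced_word :: "(sign \<times> 'a) list \<Rightarrow> (sign \<times> 'a) list" where
  "reduced_word w = (THE v. cancel\<^sup>*\<^sup>* w v \<and> (\<nexists>u. cancel v u))"

(* The reduced word is well defined: the following function computes it. *)
fun cancel_cons :: "sign \<times> 'a \<Rightarrow> (sign \<times> 'a) list \<Rightarrow> (sign \<times> 'a) list" where
  "cancel_cons (Minus, p) ((Plus, q) # ys) = ys"
| "cancel_cons x ys = x # ys"

definition reduce :: "(sign \<times> 'a) list \<Rightarrow> (sign \<times> 'a) list" where
  "reduce w = foldr cancel_cons w []"

lemma cancel_Cons: "cancel u v \<Longrightarrow> cancel (x # u) (x # v)"
  by (metis append_Cons cancel.simps)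

lemma rtranclp_cancel_Cons: "cancel\<^sup>*\<^sup>* u v \<Longrightarrow> cancel\<^sup>*\<^sup>* (x # u) (x # v)"
  by (induction rule: rtranclp_induct) (auto intro: cancel_Cons rtranclp.rtrancl_into_rtrancl)

lemma cancel_cons_reachable: "cancel\<^sup>*\<^sup>* (x # u) (cancel_cons x u)"
  by (induction x u rule: cancel_cons.induct)
    (auto intro!: r_into_rtranclp cancel.intros[of "[]", simplified])

lemma cancel_reduce: "cancel\<^sup>*\<^sup>* w (reduce w)"
proof (induction w)
  case (Cons x w)
  then show ?case
    by (metis cancel_cons_reachable foldr.simps(2) o_apply reduce_def rtranclp_cancel_Cons
        rtranclp_trans)
qed (simp add: reduce_def)

(* Reduced words: no plus to the right of a minus. *)
lemma reduce_form:
  "\<exists>us vs. reduce w = us @ vs \<and> (\<forall>x\<in>set us. fst x = Plus) \<and> (\<forall>x\<in>set vs. fst x = Minus)"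
proof (induction w)
  case (Cons x w)
  then obtain us vs where *: "reduce w = us @ vs"
    "\<forall>x\<in>set us. fst x = Plus" "\<forall>x\<in>set vs. fst x = Minus"
    by blast
  obtain s p where x: "x = (s, p)"
    by fastforce
  have red: "reduce (x # w) = cancel_cons x (us @ vs)"
    using * by (simp add: reduce_def)
  show ?case
  proof (cases s)
    case Plus
    then show ?thesis
      using * red x by (intro exI[of _ "x # us"] exI[of _ vs]) auto
  next
    case Minus
    show ?thesis
    proof (cases us)
      case Nil
      then have "reduce (x # w) = x # vs"
        using Minus red x * by (cases "(x, vs)" rule: cancel_cons.cases) auto
      then show ?thesis
        using * x Minus by (intro exI[of _ "[]"] exI[of _ "x # vs"]) auto
    next
      case (Cons y us')
      then show ?thesis
        using Minus red x * by (intro exI[of _ us'] exI[of _ vs]) (cases y, auto)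
    qed
  qed
qed (simp add: reduce_def)

lemma reduce_cancel:
  assumes "cancel u v"
  shows "reduce u = reduce v"
  using assms
proof cases
  case (1 xs p q ys)
  obtain us vs where *: "reduce ys = us @ vs"
    "\<forall>x\<in>set us. fst x = Plus" "\<forall>x\<in>set vs. fst x = Minus"
    using reduce_form by blast
  have "cancel_cons (Plus, q) (reduce ys) = (Plus, q) # reduce ys"
    by simp
  then show ?thesis
    using 1 by (simp add: reduce_def)
qed

lemma reduce_normal: "\<nexists>u. cancel (reduce w) u"
proof
  assume "\<exists>u. cancel (reduce w) u"
  then obtain xs p q ys where w: "reduce w = xs @ [(Minus, p), (Plus, q)] @ ys"
    by (auto elim: cancel.cases)
  have "reduce w = us @ vs \<Longrightarrow> \<forall>x\<in>set us. fst x = Plus \<Longrightarrow> \<forall>x\<in>set vs. fst x = Minus \<Longrightarrow> False"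
    for us vs
  proof -
    assume *: "reduce w = us @ vs" "\<forall>x\<in>set us. fst x = Plus" "\<forall>x\<in>set vs. fst x = Minus"
    show False
    proof (cases "length xs < length us")
      case True
      then have "(us @ vs) ! length xs \<in> set us"
        by (simp add: nth_append)
      then show False
        using * w by (metis append_Cons fst_conv nth_append_length sign.distinct(1))
    next
      case False
      then have "(Plus, q) \<in> set (drop (length us) (reduce w))"
        using w by simp
      then show False
        using * by fastforce
    qed
  qed
  then show False
    using reduce_form by blast
qed

lemma reduce_id: "(\<nexists>u. cancel w u) \<Longrightarrow> reduce w = w"
  by (metis cancel_reduce converse_rtranclpE)

lemma reduced_word_eq_reduce: "reduced_word w = reduce w"
  unfolding reduced_word_def
proof (rule the_equality)
  fix v
  assume v: "cancel\<^sup>*\<^sup>* w v \<and> (\<nexists>u. cancel v u)"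
  then have "reduce w = reduce v"
    by (auto elim: rtranclp_induct simp: reduce_cancel)
  then show "v = reduce w"
    using v reduce_id by metis
qed (use cancel_reduce reduce_normal in blast)

(* None plays the role of 0. *)
definition add_by_word :: "(sign \<times> pos) list \<Rightarrow> diagram \<Rightarrow> diagram option" where
  "add_by_word w D = (let ps = filter (\<lambda>x. fst x = Plus) (reduced_word w)
     in if ps = [] then None else Some (insert (snd (last ps)) D))"

definition remove_by_word :: "(sign \<times> pos) list \<Rightarrow> diagram \<Rightarrow> diagram option" where
  "remove_by_word w D = (let ms = filter (\<lambda>x. fst x = Minus) (reduced_word w)
     in if ms = [] then None else Some (D - {snd (hd ms)}))"

definition f_tilde :: "nat \<Rightarrow> nat \<Rightarrow> diagram \<Rightarrow> diagram option" where
  "f_tilde l i D = add_by_word (signature l i D) D"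

definition e_tilde :: "nat \<Rightarrow> nat \<Rightarrow> diagram \<Rightarrow> diagram option" where
  "e_tilde l i D = remove_by_word (signature l i D) D"

definition f_hat :: "nat \<Rightarrow> nat \<Rightarrow> diagram \<Rightarrow> diagram option" where
  "f_hat l i D = add_by_word (ladder_signature l i D) D"

definition e_hat :: "nat \<Rightarrow> nat \<Rightarrow> diagram \<Rightarrow> diagram option" where
  "e_hat l i D = remove_by_word (ladder_signature l i D) D"

inductive_set ladder_crystal :: "nat \<Rightarrow> diagram set" for l :: nat where
  empty: "{} \<in> ladder_crystal l"
| step: "D \<in> ladder_crystal l \<Longrightarrow> i < l \<Longrightarrow> f_hat l i D = Some E \<Longrightarrow> E \<in> ladder_crystal l"

end

theory Submission
  imports Defs "HOL-Library.Multiset"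
begin

text \<open>Write \<open>A\<^sub>k\<close> and \<open>R\<^sub>k\<close> for the number of addable and removable boxes on the \<open>k\<close>-th ladder.
  Inclusion-exclusion along a ladder shows that \<open>A\<^sub>k\<^sub>+\<^sub>l - R\<^sub>k\<close> depends only on the numbers of boxes
  on the ladders, hence is unchanged by regularization. If, on every ladder, all pluses are read
  before all minuses, then the \<open>R\<^sub>k\<close> minuses of the \<open>k\<close>-th ladder are adjacent to the \<open>A\<^sub>k\<^sub>+\<^sub>l\<close> pluses
  of the next ladder of the same residue, so the reduced word, with boxes replaced by their ladders,
  is determined by these differences. The signature of a regularization has this form; so has the
  ladder signature of a partition which has no box with arm \<open>m\<close> and leg \<open>(l - 1) m - 1\<close>. The latter
  condition is preserved by the operators of the ladder crystal: the sign following the rightmost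
  remaining plus is a minus, and this excludes the only way in which adding a box could violate
  it.\<close>

section \<open>Reduced words\<close>

text \<open>Both factors may be reduced first: the right one because \<open>reduce\<close> is a
  right fold, the left one because a cancellation inside a factor is a cancellation of the whole
  word and \<open>reduce\<close> is invariant under cancellation.\<close>

lemma reduce_append_cong:
  assumes "reduce u = reduce u'" "reduce v = reduce v'"
  shows "reduce (u @ v) = reduce (u' @ v')"
proof -
  have left: "reduce (x @ z) = reduce (reduce x @ z)" for x z :: "(sign \<times> 'a) list"
  proof -
    have "cancel\<^sup>*\<^sup>* (x @ z) (y @ z)" if "cancel\<^sup>*\<^sup>* x y" for y
      using that
    proof (induction rule: rtranclp_induct)
      case (step y y')
      have "cancel (y @ z) (y' @ z)"
        using step.hyps(2) by cases (use cancel.intros in fastforce)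
      then show ?case
        using step.IH by simp
    qed simp
    then have "cancel\<^sup>*\<^sup>* (x @ z) (reduce x @ z)"
      using cancel_reduce by blast
    then show ?thesis
      by (induction rule: rtranclp_induct) (auto simp: reduce_cancel)
  qed
  have right: "reduce (x @ z) = foldr cancel_cons x (reduce z)" for x z :: "(sign \<times> 'a) list"
    by (simp add: reduce_def)
  show ?thesis
    by (metis assms left right)
qed

text \<open>Cancellation looks only at the signs, so boxes may be replaced by their ladders before
  or after it.\<close>

lemma reduce_map: "reduce (map (apsnd g) w) = map (apsnd g) (reduce w)"
proof -
  have "cancel_cons (apsnd g x) (map (apsnd g) u) = map (apsnd g) (cancel_cons x u)" for x u
    by (induction x u rule: cancel_cons.induct) auto
  then show ?thesis
    by (induction w) (auto simp: reduce_def)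
qed

lemma reduce_Cons: "reduce (x # w) = cancel_cons x (reduce w)"
  by (simp add: reduce_def)

lemma reduce_ConsE:
  assumes "reduce w = us @ vs" "\<forall>x\<in>set us. fst x = Plus" "\<forall>x\<in>set vs. fst x = Minus"
  shows "reduce (x # w) =
    (if fst x = Plus then x # us @ vs else if us = [] then x # vs else tl us @ vs)"
proof (cases "fst x")
  case Plus
  then show ?thesis
    using assms by (cases x) (auto simp: reduce_Cons)
next
  case Minus
  show ?thesis
  proof (cases us)
    case Nil
    then show ?thesis
      using assms Minus by (cases x; cases vs) (auto simp: reduce_Cons elim!: cancel_cons.elims)
  next
    case (Cons y us')
    then show ?thesis
      using assms Minus by (cases x; cases y) (auto simp: reduce_Cons)
  qed
qed

lemma filter_reduce_Cons:
  assumes "reduce w = us @ vs" "\<forall>x\<in>set us. fst x = Plus" "\<forall>x\<in>set vs. fst x = Minus"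
  shows "filter (\<lambda>x. fst x = Plus) (reduce (x # w)) = (if fst x = Plus then x # us else tl us)"
    and "filter (\<lambda>x. fst x = Minus) (reduce (x # w)) =
      (if fst x = Minus \<and> us = [] then x # vs else vs)"
proof -
  have "\<forall>x\<in>set (tl us). fst x = Plus"
    using assms(2) by (metis list.sel(2) list.set_sel(2))
  then have "filter (\<lambda>x. fst x = Plus) us = us" "filter (\<lambda>x. fst x = Plus) vs = []"
    "filter (\<lambda>x. fst x = Plus) (tl us) = tl us" "filter (\<lambda>x. fst x = Minus) us = []"
    "filter (\<lambda>x. fst x = Minus) vs = vs" "filter (\<lambda>x. fst x = Minus) (tl us) = []"
    using assms(2,3) by (simp_all add: filter_empty_conv)
  then show "filter (\<lambda>x. fst x = Plus) (reduce (x # w)) =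
      (if fst x = Plus then x # us else tl us)"
    "filter (\<lambda>x. fst x = Minus) (reduce (x # w)) =
      (if fst x = Minus \<and> us = [] then x # vs else vs)"
    using sign.exhaust[of "fst x"] by (auto simp: reduce_ConsE[OF assms])
qed

text \<open>A plus directly after a remaining plus remains as well, since a minus free to cancel it
  would already have cancelled the earlier one. In the induction, letters put in front do not change
  the last remaining plus as long as one remains.\<close>

lemma last_plus_followed_by_minus:
  assumes "filter (\<lambda>x. fst x = Plus) (reduce w) \<noteq> []"
  obtains us vs where "w = us @ last (filter (\<lambda>x. fst x = Plus) (reduce w)) # vs"
    "vs = [] \<or> fst (hd vs) = Minus"
proof -
  have "\<exists>us vs. w = us @ last (filter (\<lambda>x. fst x = Plus) (reduce w)) # vs \<and>
    (vs = [] \<or> fst (hd vs) = Minus)"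
    using assms
  proof (induction w)
    case (Cons x w)
    obtain ps ms where red: "reduce w = ps @ ms"
      "\<forall>x\<in>set ps. fst x = Plus" "\<forall>x\<in>set ms. fst x = Minus"
      using reduce_form by blast
    have plus: "filter (\<lambda>x. fst x = Plus) (reduce w) = ps"
      using red by (auto simp: filter_empty_conv)
    note plus' = filter_reduce_Cons(1)[OF red, of x]
    show ?case
    proof (cases "ps = []")
      case True
      then have "fst x = Plus"
        using Cons.prems plus' by (auto split: if_splits)
      moreover have "w = [] \<or> fst (hd w) = Minus"
      proof (rule ccontr)
        assume "\<not> (w = [] \<or> fst (hd w) = Minus)"
        then obtain y w' where "w = y # w'" "fst y = Plus"
          by (metis list.collapse sign.exhaust)
        then have "y \<in> set (reduce w)"
          by (cases y) (simp add: reduce_Cons)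
        then show False
          using red True \<open>fst y = Plus\<close> by auto
      qed
      ultimately show ?thesis
        using True plus' by (intro exI[of _ "[]"] exI[of _ w]) simp
    next
      case False
      then obtain us vs where "w = us @ last ps # vs" "vs = [] \<or> fst (hd vs) = Minus"
        using Cons.IH plus by auto
      moreover have "last (filter (\<lambda>x. fst x = Plus) (reduce (x # w))) = last ps"
        using Cons.prems False unfolding plus' by (auto simp: last_tl split: if_splits)
      ultimately show ?thesis
        by (intro exI[of _ "x # us"] exI[of _ vs]) simp
    qed
  qed (simp add: reduce_def)
  then show thesis
    using that by blast
qed

text \<open>Dually, a minus directly before the leftmost remaining minus would itself remain. The
  induction now extends the word on the side in question, so it also carries that no plus remains if
  this minus is the first letter: then a further minus in front would become the leftmost remaining
  one.\<close>

lemma first_minus_preceded_by_plus: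
  assumes "filter (\<lambda>x. fst x = Minus) (reduce w) \<noteq> []"
  obtains us vs where "w = us @ hd (filter (\<lambda>x. fst x = Minus) (reduce w)) # vs"
    "us = [] \<or> fst (last us) = Plus"
proof -
  have "\<exists>us vs. w = us @ hd (filter (\<lambda>x. fst x = Minus) (reduce w)) # vs \<and>
    (us = [] \<or> fst (last us) = Plus) \<and>
    (us = [] \<longrightarrow> filter (\<lambda>x. fst x = Plus) (reduce w) = [])"
    using assms
  proof (induction w)
    case (Cons x w)
    obtain ps ms where red: "reduce w = ps @ ms"
      "\<forall>x\<in>set ps. fst x = Plus" "\<forall>x\<in>set ms. fst x = Minus"
      using reduce_form by blast
    have plus: "filter (\<lambda>x. fst x = Plus) (reduce w) = ps"
      "filter (\<lambda>x. fst x = Minus) (reduce w) = ms"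
      using red by (auto simp: filter_empty_conv)
    note plus' = filter_reduce_Cons(1)[OF red, of x] and minus' = filter_reduce_Cons(2)[OF red, of x]
    show ?case
    proof (cases "fst x = Minus \<and> ps = []")
      case True
      then show ?thesis
        unfolding minus' plus' by (intro exI[of _ "[]"] exI[of _ w]) simp
    next
      case False
      then have "ms \<noteq> []"
        using Cons.prems minus' by auto
      then obtain us vs where "w = us @ hd ms # vs" "us = [] \<or> fst (last us) = Plus"
        "us = [] \<longrightarrow> ps = []"
        using Cons.IH plus by auto
      moreover from this have "fst (last (x # us)) = Plus"
        using False sign.exhaust[of "fst x"] by auto
      moreover have "filter (\<lambda>x. fst x = Minus) (reduce (x # w)) = ms"
        using False by (simp only: minus' if_False)
      ultimately show ?thesis
        by (intro exI[of _ "x # us"] exI[of _ vs]) simp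
    qed
  qed (simp add: reduce_def)
  then show thesis
    using that by blast
qed

section \<open>Words sorted by ladder, with pluses before minuses on each ladder\<close>

definition code :: "sign \<times> nat \<Rightarrow> nat" where
  "code x = 2 * snd x + (if fst x = Minus then 1 else 0)"

lemma inj_code: "inj code"
proof (rule injI)
  fix x y assume "code x = code y"
  moreover have "code x div 2 = snd x" "code y div 2 = snd y"
    "code x mod 2 = (if fst x = Minus then 1 else 0)"
    "code y mod 2 = (if fst y = Minus then 1 else 0)"
    by (auto simp: code_def)
  ultimately have "snd x = snd y" "fst x = Minus \<longleftrightarrow> fst y = Minus"
    by (metis, metis zero_neq_one)
  then show "x = y"
    by (metis prod.expand sign.exhaust)
qed

text \<open>The blocks are offset against the ladders: each step appends the minuses of one ladder
  together with the pluses of the next, the two groups that cancel. The word stops before the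
  minuses of ladder \<open>n\<close>.\<close>

fun ladder_word :: "(nat \<Rightarrow> nat) \<Rightarrow> (nat \<Rightarrow> nat) \<Rightarrow> nat \<Rightarrow> (sign \<times> nat) list" where
  "ladder_word A R 0 = replicate (A 0) (Plus, 0)"
| "ladder_word A R (Suc n) =
     ladder_word A R n @ replicate (R n) (Minus, n) @ replicate (A (Suc n)) (Plus, Suc n)"

lemma count_ladder_word:
  "count (mset (ladder_word A R n)) (Plus, j) = (if j \<le> n then A j else 0)"
  "count (mset (ladder_word A R n)) (Minus, j) = (if j < n then R j else 0)"
  by (induction n) auto

lemma sorted_ladder_word: "sorted (map code (ladder_word A R n))"
proof -
  have "set (ladder_word A R n) \<subseteq> {x. code x \<le> 2 * n}" for n
    by (induction n) (auto simp: code_def)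
  then show ?thesis
    by (induction n) (fastforce simp: sorted_append code_def)+
qed

text \<open>A list sorted by an injective key is determined by its multiset. All labels are below
  \<open>n\<close>, so the minuses of ladder \<open>n\<close>, which \<open>ladder_word\<close>
  omits, do not occur.\<close>

lemma sorted_word_eq_ladder_word:
  assumes "sorted (map code w)" "\<And>x. x \<in> set w \<Longrightarrow> snd x < n"
  shows "w = ladder_word (\<lambda>j. count (mset w) (Plus, j)) (\<lambda>j. count (mset w) (Minus, j)) n"
    (is "w = ?v")
proof -
  have "mset w = mset ?v"
  proof (rule multiset_eqI)
    fix x :: "sign \<times> nat"
    have "count (mset w) x = 0" if "snd x \<ge> n"
      using that assms(2)[of x] by (auto simp: count_eq_zero_iff)
    then show "count (mset w) x = count (mset ?v) x"
      by (cases x; cases "fst x") (auto simp: count_ladder_word)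
  qed
  then have "mset (map code w) = mset (map code ?v)"
    by simp
  then have "map code w = map code ?v"
    using assms(1) sorted_ladder_word by (metis properties_for_sort)
  then show ?thesis
    using inj_code by (meson inj_map_eq_map)
qed

lemma reduce_replicate_minus_plus:
  "reduce (replicate r (Minus, p) @ replicate a (Plus, q)) =
    (if r \<le> a then replicate (a - r) (Plus, q) else replicate (r - a) (Minus, p))"
proof (induction r)
  case 0
  have "reduce (replicate a (Plus, q)) = replicate a (Plus, q)" for a
    by (induction a) (auto simp: reduce_def)
  then show ?case
    by simp
next
  case (Suc r)
  show ?case
  proof (cases "Suc r \<le> a")
    case True
    then have "a - r = Suc (a - Suc r)"
      by simp
    then show ?thesis
      using Suc True by (simp add: reduce_Cons)
  next
    case False
    then show ?thesis
      using Suc by (cases "r - a") (auto simp: reduce_Cons Suc_diff_le)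
  qed
qed

text \<open>Only the differences of the number of pluses on a ladder and the number of minuses on the
  preceding ladder of the same residue matter, since these signs are adjacent and cancel.\<close>

lemma reduce_ladder_word_cong:
  assumes "A 0 = A' 0" "\<And>j. A (Suc j) + R' j = A' (Suc j) + R j"
  shows "reduce (ladder_word A R n) = reduce (ladder_word A' R' n)"
proof (induction n)
  case (Suc n)
  have "R n \<le> A (Suc n) \<longleftrightarrow> R' n \<le> A' (Suc n)" "A (Suc n) - R n = A' (Suc n) - R' n"
    "R n - A (Suc n) = R' n - A' (Suc n)"
    using assms(2)[of n] by linarith+
  then have "reduce (replicate (R n) (Minus, n) @ replicate (A (Suc n)) (Plus, Suc n)) =
    reduce (replicate (R' n) (Minus, n) @ replicate (A' (Suc n)) (Plus, Suc n))"
    by (simp only: reduce_replicate_minus_plus)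
  then show ?case
    using Suc reduce_append_cong by simp
qed (simp add: assms(1))

text \<open>The last assumption equates the differences between pluses on one ladder and minuses on
  the ladder before, written with sums to avoid truncated subtraction. One bound \<open>n\<close>
  for both words makes them ladder words with the same number of blocks.\<close>

lemma reduce_sorted_cong:
  assumes "sorted (map code v)" "sorted (map code w)"
    and "count (mset v) (Plus, 0) = count (mset w) (Plus, 0)"
    and "\<And>j. count (mset v) (Plus, Suc j) + count (mset w) (Minus, j) =
      count (mset w) (Plus, Suc j) + count (mset v) (Minus, j)"
  shows "reduce v = reduce w"
proof -
  have "finite (snd ` (set v \<union> set w))"
    by simp
  then obtain n where "\<forall>j\<in>snd ` (set v \<union> set w). j < n"
    using finite_nat_set_iff_bounded by blast
  then have *: "v = ladder_word (\<lambda>j. count (mset v) (Plus, j)) (\<lambda>j. count (mset v) (Minus, j)) n"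
      (is "_ = ?v")
    "w = ladder_word (\<lambda>j. count (mset w) (Plus, j)) (\<lambda>j. count (mset w) (Minus, j)) n"
      (is "_ = ?w")
    using assms(1,2) by (auto intro!: sorted_word_eq_ladder_word)
  have "reduce v = reduce ?v"
    using *(1) by (rule arg_cong)
  also have "\<dots> = reduce ?w"
    by (rule reduce_ladder_word_cong) (use assms(3,4) in simp_all)
  also have "\<dots> = reduce w"
    using *(2) by (rule arg_cong[OF sym])
  finally show ?thesis .
qed

section \<open>Partitions, ladders and regularization\<close>

text \<open>Ranking by the injective \<open>f\<close> is a bijection from \<open>S\<close> onto the
  numbers below \<open>card S\<close>.\<close>

lemma card_rank_less:
  fixes f :: "'a \<Rightarrow> nat"
  assumes "finite S" "inj_on f S" "n \<le> card S"
  shows "card {p \<in> S. card {q \<in> S. f q < f p} < n} = n"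
proof -
  define rank where "rank p = card {q \<in> S. f q < f p}" for p
  have mono: "rank p < rank q" if "p \<in> S" "f p < f q" for p q
    unfolding rank_def using assms(1) that by (intro psubset_card_mono) auto
  have "inj_on rank S"
  proof (rule inj_onI)
    fix p q assume "p \<in> S" "q \<in> S" "rank p = rank q"
    then have "f p = f q"
      using mono by (metis less_irrefl nat_neq_iff)
    then show "p = q"
      using \<open>p \<in> S\<close> \<open>q \<in> S\<close> assms(2) by (simp add: inj_on_eq_iff)
  qed
  moreover have "rank p < card S" if "p \<in> S" for p
    unfolding rank_def using assms(1) that by (intro psubset_card_mono) auto
  then have "rank ` S \<subseteq> {..<card S}"
    by blast
  ultimately have "rank ` S = {..<card S}"
    by (metis card_image card_lessThan card_subset_eq finite_lessThan)
  moreover have "rank ` {p \<in> S. rank p < n} = rank ` S \<inter> {..<n}"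
    by auto
  ultimately have "rank ` {p \<in> S. rank p < n} = {..<n}"
    using assms(3) by auto
  moreover have "inj_on rank {p \<in> S. rank p < n}"
    using \<open>inj_on rank S\<close> by (rule inj_on_subset) auto
  ultimately have "card {p \<in> S. rank p < n} = n"
    by (metis card_image card_lessThan)
  then show ?thesis
    by (simp add: rank_def)
qed

lemma is_partition_pos: "is_partition D \<Longrightarrow> p \<in> D \<Longrightarrow> is_pos p"
  unfolding is_partition_def by blast

lemma is_partition_downward:
  "is_partition D \<Longrightarrow> (a, b) \<in> D \<Longrightarrow> 1 \<le> c \<Longrightarrow> c \<le> a \<Longrightarrow> 1 \<le> d \<Longrightarrow> d \<le> b \<Longrightarrow> (c, d) \<in> D"
  unfolding is_partition_def by blast

section \<open>Corners: addable and removable boxes of any residue\<close>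

definition outer_corner :: "diagram \<Rightarrow> pos \<Rightarrow> bool" where
  "outer_corner D p \<longleftrightarrow> p \<notin> D \<and> is_partition (insert p D)"

definition inner_corner :: "diagram \<Rightarrow> pos \<Rightarrow> bool" where
  "inner_corner D p \<longleftrightarrow> p \<in> D \<and> is_partition (D - {p})"

lemma outer_corner_iff:
  assumes "is_partition D"
  shows "outer_corner D (a, b) \<longleftrightarrow> (a, b) \<notin> D \<and> 1 \<le> a \<and> 1 \<le> b \<and>
    (a = 1 \<or> (a - 1, b) \<in> D) \<and> (b = 1 \<or> (a, b - 1) \<in> D)"
    (is "?l \<longleftrightarrow> ?r")
proof
  assume ?l
  then have *: "(a, b) \<notin> D" "is_partition (insert (a, b) D)"
    by (auto simp: outer_corner_def)
  then have "1 \<le> a" "1 \<le> b"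
    using is_partition_pos[OF *(2), of "(a, b)"] by (auto simp: is_pos_def)
  moreover have "(a - 1, b) \<in> D" if "a \<noteq> 1"
  proof -
    have "1 \<le> a - 1"
      using that \<open>1 \<le> a\<close> by simp
    then show ?thesis
      using \<open>1 \<le> b\<close> is_partition_downward[OF *(2), of a b "a - 1" b] by auto
  qed
  moreover have "(a, b - 1) \<in> D" if "b \<noteq> 1"
  proof -
    have "1 \<le> b - 1"
      using that \<open>1 \<le> b\<close> by simp
    then show ?thesis
      using \<open>1 \<le> a\<close> is_partition_downward[OF *(2), of a b a "b - 1"] by auto
  qed
  ultimately show ?r
    using * by blast
next
  assume r: ?r
  have "(c, d) \<in> insert (a, b) D"
    if "(a', b') \<in> insert (a, b) D" "1 \<le> c" "c \<le> a'" "1 \<le> d" "d \<le> b'" for a' b' c d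
  proof (cases "(a', b') \<in> D")
    case True
    then show ?thesis
      using that is_partition_downward[OF assms True] by simp
  next
    case False
    then have [simp]: "a' = a" "b' = b"
      using that by auto
    have "c \<le> a" "d \<le> b"
      using that by simp_all
    then consider "c = a \<and> d = b" | "c < a" | "d < b"
      by linarith
    then show ?thesis
    proof cases
      case 2
      then show ?thesis
        using r that is_partition_downward[OF assms, of "a - 1" b c d] by simp
    next
      case 3
      then show ?thesis
        using r that is_partition_downward[OF assms, of a "b - 1" c d] by simp
    qed simp
  qed
  then have "is_partition (insert (a, b) D)"
    using assms r unfolding is_partition_def by (auto simp: is_pos_def)
  then show ?l
    using r by (simp add: outer_corner_def)
qed

lemma inner_corner_iff:
  assumes "is_partition D"
  shows "inner_corner D (a, b) \<longleftrightarrow> (a, b) \<in> D \<and> (a + 1, b) \<notin> D \<and> (a, b + 1) \<notin> D"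
    (is "?l \<longleftrightarrow> ?r")
proof
  assume ?l
  then have *: "(a, b) \<in> D" "is_partition (D - {(a, b)})"
    by (auto simp: inner_corner_def)
  then have "1 \<le> a" "1 \<le> b"
    using is_partition_pos[OF assms, of "(a, b)"] by (auto simp: is_pos_def)
  then show ?r
    using * is_partition_downward[OF *(2), of "a + 1" b a b]
      is_partition_downward[OF *(2), of a "b + 1" a b] by auto
next
  assume r: ?r
  have "(c, d) \<noteq> (a, b)"
    if "(a', b') \<in> D - {(a, b)}" "1 \<le> c" "c \<le> a'" "1 \<le> d" "d \<le> b'" for a' b' c d
  proof
    assume eq: "(c, d) = (a, b)"
    then have "a \<le> a'" "b \<le> b'" "a' \<noteq> a \<or> b' \<noteq> b"
      using that by auto
    then consider "a + 1 \<le> a'" | "b + 1 \<le> b'"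
      by linarith
    then show False
      using r that eq is_partition_downward[OF assms, of a' b' "a + 1" b]
        is_partition_downward[OF assms, of a' b' a "b + 1"] by cases auto
  qed
  then have "is_partition (D - {(a, b)})"
    using assms unfolding is_partition_def by blast
  then show ?l
    using r by (simp add: inner_corner_def)
qed

section \<open>Ladders by index, and diagrams filling the top of their ladders\<close>

definition Ladder :: "nat \<Rightarrow> nat \<Rightarrow> pos set" where
  "Ladder l k = {p. is_pos p \<and> ladder_index l p = k}"

text \<open>Adding \<open>l - 1\<close> to both indices removes the truncated
  \<open>snd p - 1\<close>, since columns are at least 1.\<close>

lemma ladder_index_eq_iff:
  assumes "is_pos p" "is_pos q"
  shows "ladder_index l p = ladder_index l q \<longleftrightarrow>
    fst p + (l - 1) * snd p = fst q + (l - 1) * snd q"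
proof -
  have "ladder_index l p + (l - 1) = fst p + (l - 1) * snd p" if "is_pos p" for p
    using that by (cases "snd p") (auto simp: ladder_index_def is_pos_def)
  then show ?thesis
    using assms by (metis add_right_cancel)
qed

lemma ladder_eq_Ladder:
  assumes "1 \<le> l" "is_pos p"
  shows "ladder l p = Ladder l (ladder_index l p)"
proof -
  have "int (fst q) - int (fst p) = (int l - 1) * (int (snd p) - int (snd q)) \<longleftrightarrow>
    fst q + (l - 1) * snd q = fst p + (l - 1) * snd p" for q
  proof -
    have "int (fst q + (l - 1) * snd q) = int (fst q) + (int l - 1) * int (snd q)" for q
      using assms(1) by (simp add: of_nat_diff)
    then show ?thesis
      by (smt (verit) of_nat_eq_iff right_diff_distrib)
  qed
  then show ?thesis
    using assms(2) by (auto simp: ladder_def Ladder_def ladder_index_eq_iff)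
qed

lemma finite_Ladder:
  assumes "2 \<le> l"
  shows "finite (Ladder l k)"
proof (rule finite_subset)
  show "Ladder l k \<subseteq> {..k} \<times> {..Suc k}"
  proof
    fix p assume p: "p \<in> Ladder l k"
    have "1 * (snd p - 1) \<le> (l - 1) * (snd p - 1)"
      using assms by (intro mult_right_mono) auto
    moreover have "fst p + (l - 1) * (snd p - 1) = k"
      using p by (simp add: Ladder_def ladder_index_def)
    ultimately have "fst p \<le> k" "snd p \<le> Suc k"
      by linarith+
    then show "p \<in> {..k} \<times> {..Suc k}"
      by (cases p) simp
  qed
qed simp

lemma inj_on_fst_Ladder: "2 \<le> l \<Longrightarrow> inj_on fst (Ladder l k)"
proof (rule inj_onI)
  fix p q assume "2 \<le> l" "p \<in> Ladder l k" "q \<in> Ladder l k" "fst p = fst q"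
  then have "(l - 1) * snd p = (l - 1) * snd q"
    using ladder_index_eq_iff[of p q l] by (auto simp: Ladder_def)
  then show "p = q"
    using \<open>2 \<le> l\<close> \<open>fst p = fst q\<close> by (auto simp: prod_eq_iff)
qed

text \<open>For \<open>2 \<le> l\<close> these are the diagrams equal to their own
  regularization.\<close>

definition top_closed :: "nat \<Rightarrow> diagram \<Rightarrow> bool" where
  "top_closed l E \<longleftrightarrow> (\<forall>p\<in>E. is_pos p \<and>
    (\<forall>q. is_pos q \<and> ladder_index l q = ladder_index l p \<and> fst q \<le> fst p \<longrightarrow> q \<in> E))"

lemma top_closed_pos: "top_closed l E \<Longrightarrow> p \<in> E \<Longrightarrow> is_pos p"
  unfolding top_closed_def by blast

lemma top_closedD:
  "top_closed l E \<Longrightarrow> p \<in> E \<Longrightarrow> is_pos q \<Longrightarrow> ladder_index l q = ladder_index l p \<Longrightarrow>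
    fst q \<le> fst p \<Longrightarrow> q \<in> E"
  unfolding top_closed_def by blast

lemma regularization_iff:
  assumes "1 \<le> l"
  shows "p \<in> regularization l D \<longleftrightarrow> is_pos p \<and>
    card {q \<in> Ladder l (ladder_index l p). fst q < fst p} <
      card (D \<inter> Ladder l (ladder_index l p))"
  by (cases "is_pos p") (simp_all add: regularization_def ladder_eq_Ladder[OF assms])

lemma card_regularization:
  assumes "2 \<le> l"
  shows "card (regularization l D \<inter> Ladder l k) = card (D \<inter> Ladder l k)"
proof -
  have "regularization l D \<inter> Ladder l k =
    {p \<in> Ladder l k. card {q \<in> Ladder l k. fst q < fst p} < card (D \<inter> Ladder l k)}"
    using assms by (auto simp: regularization_iff) (auto simp: Ladder_def)
  moreover have "card (D \<inter> Ladder l k) \<le> card (Ladder l k)"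
    using assms by (intro card_mono finite_Ladder) auto
  ultimately show ?thesis
    using card_rank_less[OF finite_Ladder[OF assms] inj_on_fst_Ladder[OF assms]] by simp
qed

lemma top_closed_regularization:
  assumes "2 \<le> l"
  shows "top_closed l (regularization l D)"
  unfolding top_closed_def
proof (intro ballI conjI allI impI)
  fix p q
  assume p: "p \<in> regularization l D"
    and q: "is_pos q \<and> ladder_index l q = ladder_index l p \<and> fst q \<le> fst p"
  have "card {r \<in> Ladder l (ladder_index l p). fst r < fst q} \<le>
    card {r \<in> Ladder l (ladder_index l p). fst r < fst p}"
    using q assms by (intro card_mono) (auto simp: finite_Ladder)
  then show "q \<in> regularization l D"
    using p q assms by (simp add: regularization_iff)
qed (use assms in \<open>simp add: regularization_iff\<close>)

text \<open>On one ladder, top-closed diagrams are initial segments in the order of rows, hence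
  nested, and equal size makes them equal. In this way the regularization is identified after a box
  has been added or removed.\<close>

lemma regularization_unique:
  assumes "2 \<le> l" "top_closed l E" "\<And>k. card (E \<inter> Ladder l k) = card (D \<inter> Ladder l k)"
  shows "regularization l D = E"
proof -
  have "regularization l D \<inter> Ladder l k = E \<inter> Ladder l k" (is "?R = ?E") for k
  proof -
    have fin: "finite ?R" "finite ?E"
      using finite_Ladder[OF assms(1)] by auto
    have "?R \<subseteq> ?E \<or> ?E \<subseteq> ?R"
    proof (rule ccontr)
      assume "\<not> ?thesis"
      then obtain p q where "p \<in> ?R" "p \<notin> ?E" "q \<in> ?E" "q \<notin> ?R"
        by blast
      moreover have "r \<in> F" if "top_closed l F" "s \<in> F" "s \<in> Ladder l k" "r \<in> Ladder l k"
        "fst r \<le> fst s" for r s F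
        using that top_closedD[of l F s r] by (simp add: Ladder_def)
      ultimately show False
        using assms(2) top_closed_regularization[OF assms(1), of D] nat_le_linear[of "fst p" "fst q"]
        by blast
    qed
    moreover have "card ?R = card ?E"
      using assms by (simp add: card_regularization)
    ultimately show ?thesis
      using fin card_subset_eq by metis
  qed
  moreover have "p \<in> Ladder l (ladder_index l p)" if "p \<in> regularization l D \<or> p \<in> E" for p
  proof -
    have "is_pos p"
      using that assms(2) top_closed_regularization[OF assms(1), of D] top_closed_pos by blast
    then show ?thesis
      by (simp add: Ladder_def)
  qed
  ultimately show ?thesis
    by blast
qed

section \<open>Counting corners along ladders\<close>

lemma card_Ladder_shift:
  assumes "1 \<le> l"
  shows "card {p \<in> Ladder l k. is_pos (fst p - x, snd p - y) \<and> Q (fst p - x, snd p - y)} =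
    card {q. is_pos q \<and> Q q \<and> ladder_index l q + (x + (l - 1) * y) = k}"
proof -
  let ?s = "\<lambda>q. (fst q + x, snd q + y) :: pos"
  have idx: "ladder_index l (?s q) = ladder_index l q + (x + (l - 1) * y)" if "is_pos q" for q
  proof -
    have "snd q + y - 1 = snd q - 1 + y"
      using that by (simp add: is_pos_def)
    then show ?thesis
      unfolding ladder_index_def fst_conv snd_conv by (simp only: add_mult_distrib2 ac_simps)
  qed
  \<comment> \<open>Translation is inverted by subtraction; where the subtraction truncates, a
    coordinate becomes 0 and \<open>is_pos\<close> excludes the position.\<close>
  have "bij_betw ?s {q. is_pos q \<and> Q q \<and> ladder_index l q + (x + (l - 1) * y) = k}
    {p \<in> Ladder l k. is_pos (fst p - x, snd p - y) \<and> Q (fst p - x, snd p - y)}"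
    (is "bij_betw _ ?A ?B")
  proof (rule bij_betw_byWitness[where f' = "\<lambda>p. (fst p - x, snd p - y)"])
    show "?s ` ?A \<subseteq> ?B"
      using idx by (auto simp: Ladder_def) (auto simp: is_pos_def)
    show "(\<lambda>p. (fst p - x, snd p - y)) ` ?B \<subseteq> ?A"
    proof
      fix q assume "q \<in> (\<lambda>p. (fst p - x, snd p - y)) ` ?B"
      then obtain p where "p \<in> ?B" "q = (fst p - x, snd p - y)"
        by blast
      moreover from this have "x < fst p" "y < snd p"
        by (auto simp: is_pos_def)
      then have "(fst p - x + x, snd p - y + y) = p"
        by (cases p) simp
      ultimately show "q \<in> ?A"
        using idx[of q] by (simp add: Ladder_def)
    qed
  qed (auto simp: is_pos_def)
  then show ?thesis
    by (simp add: bij_betw_same_card)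
qed

text \<open>Row 0 and column 0 count as filled, so that the corners of a partition can be recognized
  by the same formula along the border of the quadrant and in its interior.\<close>

definition filled :: "diagram \<Rightarrow> pos \<Rightarrow> bool" where
  "filled D p \<longleftrightarrow> p \<in> D \<or> \<not> is_pos p"

text \<open>An alternating sum over the four cells of a 2 by 2 square. Filled cells are closed under
  going up and left, so the sum is 1 if only the lower right cell is empty, -1 if only the upper
  left cell is filled, and 0 otherwise.\<close>

lemma corner_balance:
  assumes "is_partition D"
  shows "of_bool (filled D (a, Suc b)) + of_bool (filled D (Suc a, b))
      - of_bool (filled D (a, b)) - of_bool (filled D (Suc a, Suc b)) =
    of_bool (outer_corner D (Suc a, Suc b))
      - (of_bool (is_pos (a, b) \<and> inner_corner D (a, b)) :: int)"
proof -
  have down: "(c, d) \<in> D" if "(c', d') \<in> D" "is_pos (c, d)" "c \<le> c'" "d \<le> d'" for c c' d d'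
    using is_partition_downward[OF assms that(1)] that(2-) by (simp add: is_pos_def)
  have "(0, y) \<notin> D" "(x, 0) \<notin> D" for x y
    using is_partition_pos[OF assms] by (fastforce simp: is_pos_def)+
  then show ?thesis
    using down[of a "Suc b" a b] down[of "Suc a" b a b] down[of "Suc a" "Suc b" a "Suc b"]
      down[of "Suc a" "Suc b" "Suc a" b]
    unfolding filled_def outer_corner_iff[OF assms] inner_corner_iff[OF assms]
    by (cases "a = 0"; cases "b = 0") (auto simp: is_pos_def of_bool_def)
qed

text \<open>Translated by \<open>x\<close> rows and \<open>y\<close> columns, the ladder splits into
  positions outside the quadrant, whose number does not depend on the diagram, and positions on the
  single ladder of index \<open>k - (x + (l - 1) * y)\<close>, or none if this is negative.\<close>

lemma sum_filled_cong:
  assumes "2 \<le> l"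
    and "\<And>k. card (D \<inter> Ladder l k) = card (E \<inter> Ladder l k)"
  shows "(\<Sum>p\<in>Ladder l k. of_bool (filled D (fst p - x, snd p - y)) :: int) =
    (\<Sum>p\<in>Ladder l k. of_bool (filled E (fst p - x, snd p - y)))"
proof -
  have *: "(\<Sum>p\<in>Ladder l k. of_bool (filled F (fst p - x, snd p - y)) :: int) =
    int (card {p \<in> Ladder l k. \<not> is_pos (fst p - x, snd p - y)}) +
    int (card {q. is_pos q \<and> q \<in> F \<and> ladder_index l q + (x + (l - 1) * y) = k})" for F
  proof -
    have "(\<Sum>p\<in>Ladder l k. of_bool (filled F (fst p - x, snd p - y)) :: int) =
      (\<Sum>p\<in>Ladder l k. of_bool (\<not> is_pos (fst p - x, snd p - y)) +
        of_bool (is_pos (fst p - x, snd p - y) \<and> (fst p - x, snd p - y) \<in> F))"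
      by (intro sum.cong) (auto simp: filled_def)
    also have "\<dots> = int (card {p \<in> Ladder l k. \<not> is_pos (fst p - x, snd p - y)}) +
      int (card {p \<in> Ladder l k. is_pos (fst p - x, snd p - y) \<and> (fst p - x, snd p - y) \<in> F})"
      using finite_Ladder[OF assms(1)] by (simp add: sum.distrib sum_of_bool_eq Int_def)
    finally show ?thesis
      using assms(1) card_Ladder_shift[of l k x y "\<lambda>q. q \<in> F"] by simp
  qed
  let ?d = "x + (l - 1) * y"
  have "{q. is_pos q \<and> q \<in> F \<and> ladder_index l q + ?d = k} =
    (if ?d \<le> k then F \<inter> Ladder l (k - ?d) else {})" for F
    by (auto simp: Ladder_def)
  then show ?thesis
    using assms(2) by (simp add: *)
qed

text \<open>Sum \<open>corner_balance\<close> over the squares whose lower right cell lies on ladder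
  \<open>k\<close>. Their upper left cells have index smaller by \<open>1 + (l - 1) = l\<close>, so
  inner corners are counted on the preceding ladder of the same residue.\<close>

lemma corner_count_balance:
  assumes "2 \<le> l" "is_partition D" "is_partition E"
    and "\<And>k. card (D \<inter> Ladder l k) = card (E \<inter> Ladder l k)"
  shows "card {p \<in> Ladder l k. outer_corner D p} +
      card {q. is_pos q \<and> inner_corner E q \<and> ladder_index l q + l = k} =
    card {p \<in> Ladder l k. outer_corner E p} +
      card {q. is_pos q \<and> inner_corner D q \<and> ladder_index l q + l = k}"
proof -
  \<comment> \<open>The shifts by 0 are written out to make all four sums instances of
    \<open>sum_filled_cong\<close>.\<close>
  have *: "int (card {p \<in> Ladder l k. outer_corner F p}) -
      int (card {q. is_pos q \<and> inner_corner F q \<and> ladder_index l q + l = k}) =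
    (\<Sum>p\<in>Ladder l k. of_bool (filled F (fst p - 1, snd p - 0))) +
    (\<Sum>p\<in>Ladder l k. of_bool (filled F (fst p - 0, snd p - 1))) -
    (\<Sum>p\<in>Ladder l k. of_bool (filled F (fst p - 1, snd p - 1))) -
    (\<Sum>p\<in>Ladder l k. of_bool (filled F (fst p - 0, snd p - 0)))"
    (is "_ = ?r") if F: "is_partition F" for F
  proof -
    have "?r = (\<Sum>p\<in>Ladder l k. of_bool (outer_corner F p) -
        of_bool (is_pos (fst p - 1, snd p - 1) \<and> inner_corner F (fst p - 1, snd p - 1)))"
      unfolding sum.distrib[symmetric] sum_subtractf[symmetric]
    proof (rule sum.cong)
      fix p assume "p \<in> Ladder l k"
      then obtain a b where "p = (Suc a, Suc b)"
        by (cases p) (auto simp: Ladder_def is_pos_def Suc_le_eq dest!: gr0_implies_Suc)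
      then show "of_bool (filled F (fst p - 1, snd p - 0)) + of_bool (filled F (fst p - 0, snd p - 1))
          - of_bool (filled F (fst p - 1, snd p - 1)) - of_bool (filled F (fst p - 0, snd p - 0)) =
        of_bool (outer_corner F p) - (of_bool (is_pos (fst p - 1, snd p - 1) \<and>
          inner_corner F (fst p - 1, snd p - 1)) :: int)"
        using corner_balance[OF F, of a b] by simp
    qed simp
    also have "\<dots> = int (card {p \<in> Ladder l k. outer_corner F p}) -
      int (card {p \<in> Ladder l k. is_pos (fst p - 1, snd p - 1) \<and>
        inner_corner F (fst p - 1, snd p - 1)})"
      using finite_Ladder[OF assms(1)] by (simp add: sum_subtractf sum_of_bool_eq Int_def)
    finally show ?thesis
      using assms(1) card_Ladder_shift[of l k 1 1 "inner_corner F"] by simp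
  qed
  show ?thesis
    using *[OF assms(2)] *[OF assms(3)] sum_filled_cong[OF assms(1,4), where k = k and x = 1 and y = 0]
      sum_filled_cong[OF assms(1,4), where k = k and x = 0 and y = 1]
      sum_filled_cong[OF assms(1,4), where k = k and x = 1 and y = 1]
      sum_filled_cong[OF assms(1,4), where k = k and x = 0 and y = 0] by linarith
qed

section \<open>Labelled signatures\<close>

lemma ladder_index_add: "is_pos (a, b) \<Longrightarrow> ladder_index l (a, b) + (l - 1) = a + (l - 1) * b"
  by (cases b) (auto simp: ladder_index_def is_pos_def)

lemma ladder_index_Suc:
  "ladder_index l (Suc a, b) = Suc (ladder_index l (a, b))"
  "1 \<le> b \<Longrightarrow> ladder_index l (a, Suc b) = ladder_index l (a, b) + (l - 1)"
  by (auto simp: ladder_index_def) (cases b; simp)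

text \<open>Modulo \<open>l\<close>, the index is 1 minus the content (column minus row), so residue
  and index modulo \<open>l\<close> determine each other.\<close>

lemma residue_iff_ladder_index:
  assumes "i < l"
  obtains r where "r < l"
    "\<And>p. is_pos p \<Longrightarrow> residue l p = int i \<longleftrightarrow> ladder_index l p mod l = r"
proof -
  let ?r = "nat ((1 - int i) mod int l)"
  have "residue l p = int i \<longleftrightarrow> ladder_index l p mod l = ?r" if "is_pos p" for p
  proof -
    obtain a b where p: "p = (a, Suc b)"
      using \<open>is_pos p\<close> by (cases p; cases "snd p") (auto simp: is_pos_def)
    have "int (ladder_index l p) = 1 - (int (Suc b) - int a) + int l * int b"
      using assms by (cases l) (simp_all add: p ladder_index_def algebra_simps)
    then have "int (ladder_index l p mod l) = (1 - (int (Suc b) - int a)) mod int l"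
      by (simp add: zmod_int)
    moreover have "residue l p = int i \<longleftrightarrow> (int (Suc b) - int a) mod int l = int i mod int l"
      using assms by (simp add: residue_def p)
    moreover have "x mod m = y mod m \<longleftrightarrow> (1 - x) mod m = (1 - y) mod m" for x y m :: int
      by (simp add: mod_eq_dvd_iff dvd_diff_commute)
    moreover have "int ?r = (1 - int i) mod int l"
      using assms by simp
    ultimately show ?thesis
      by (metis of_nat_eq_iff)
  qed
  moreover have "?r < l"
    using assms by (simp add: nat_less_iff)
  ultimately show thesis
    using that by blast
qed

lemma addable_iff: "addable l i D p \<longleftrightarrow> outer_corner D p \<and> residue l p = int i"
  by (auto simp: addable_def outer_corner_def)

lemma removable_iff: "removable l i D p \<longleftrightarrow> inner_corner D p \<and> residue l p = int i"
  by (auto simp: removable_def inner_corner_def)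

lemma signed_boxes_iff:
  "(Plus, p) \<in> signed_boxes l i D \<longleftrightarrow> outer_corner D p \<and> residue l p = int i"
  "(Minus, p) \<in> signed_boxes l i D \<longleftrightarrow> inner_corner D p \<and> residue l p = int i"
  by (auto simp: signed_boxes_def addable_iff removable_iff)

lemma signed_boxes_cases:
  assumes "x \<in> signed_boxes l i D"
  obtains (Plus) p where "x = (Plus, p)" "outer_corner D p" "residue l p = int i"
  | (Minus) p where "x = (Minus, p)" "inner_corner D p" "residue l p = int i"
  using assms by (auto simp: signed_boxes_def addable_iff removable_iff)

lemma signed_boxes_pos:
  assumes "is_partition D" "x \<in> signed_boxes l i D"
  shows "is_pos (snd x)"
  using assms(2)
proof (cases rule: signed_boxes_cases)
  case (Plus p)
  then show ?thesis
    using is_partition_pos[of "insert p D" p] by (auto simp: outer_corner_def)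
next
  case (Minus p)
  then show ?thesis
    using is_partition_pos[OF assms(1), of p] by (auto simp: inner_corner_def)
qed

lemma signed_boxes_same_residue:
  assumes "is_partition D" "is_partition E" "i < l"
    and "x \<in> signed_boxes l i D" "y \<in> signed_boxes l i E"
  shows "ladder_index l (snd x) mod l = ladder_index l (snd y) mod l"
proof -
  obtain r where "\<And>p. is_pos p \<Longrightarrow> residue l p = int i \<longleftrightarrow> ladder_index l p mod l = r"
    using residue_iff_ladder_index assms(3) by blast
  moreover have "residue l (snd z) = int i" if "z \<in> signed_boxes l i F" for z F
    using that by (cases rule: signed_boxes_cases) auto
  ultimately show ?thesis
    using assms signed_boxes_pos by metis
qed

lemma residue_cong:
  assumes "i < l" "is_pos p" "is_pos q" "ladder_index l p mod l = ladder_index l q mod l"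
  shows "residue l p = int i \<longleftrightarrow> residue l q = int i"
  using residue_iff_ladder_index[OF assms(1)] assms by metis

text \<open>Every outer corner is \<open>(1, 1)\<close> or adjacent to one of the finitely many
  boxes.\<close>

lemma finite_signed_boxes:
  assumes "is_partition D"
  shows "finite (signed_boxes l i D)"
proof -
  have fin: "finite D"
    using assms by (simp add: is_partition_def)
  have "p \<in> insert (1, 1) ((\<lambda>q. (fst q + 1, snd q)) ` D \<union> (\<lambda>q. (fst q, snd q + 1)) ` D)"
    if "outer_corner D p" for p
  proof (cases p)
    case (Pair a b)
    then have *: "1 \<le> a" "1 \<le> b" "a = 1 \<or> (a - 1, b) \<in> D" "b = 1 \<or> (a, b - 1) \<in> D"
      using that by (simp_all add: outer_corner_iff[OF assms])
    then consider "a = 1" "b = 1" | "(a - 1, b) \<in> D" | "(a, b - 1) \<in> D"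
      by blast
    then show ?thesis
      using * Pair by cases (force simp: image_iff)+
  qed
  then have "{p. outer_corner D p} \<subseteq>
      insert (1, 1) ((\<lambda>q. (fst q + 1, snd q)) ` D \<union> (\<lambda>q. (fst q, snd q + 1)) ` D)"
    by blast
  then have "finite {p. outer_corner D p}"
    by (rule finite_subset) (simp add: fin)
  moreover have "finite {p. inner_corner D p}"
    using fin by (rule finite_subset[rotated]) (auto simp: inner_corner_def)
  ultimately show ?thesis
    by (simp add: signed_boxes_def addable_iff removable_iff)
qed

lemma (in linorder) sorted_key_list_of_set_props:
  assumes "inj_on f A" "finite A"
  shows "set (sorted_key_list_of_set f A) = A"
    and "distinct (sorted_key_list_of_set f A)"
    and "sorted (map f (sorted_key_list_of_set f A))"
proof -
  interpret I: folding_insort_key "(\<le>)" "(<)" A f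
    by standard (rule assms(1))
  show "set (sorted_key_list_of_set f A) = A"
    using I.set_sorted_key_list_of_set[OF subset_refl assms(2)] .
  show "sorted (map f (sorted_key_list_of_set f A))"
    using I.sorted_sorted_key_list_of_set[OF subset_refl] .
  show "distinct (sorted_key_list_of_set f A)"
    using I.distinct_if_distinct_map[OF I.distinct_sorted_key_list_of_set[OF subset_refl]] .
qed

text \<open>Dividing the ladder index by \<open>l\<close> numbers the ladders of one residue consecutively.\<close>

definition label :: "nat \<Rightarrow> sign \<times> pos \<Rightarrow> sign \<times> nat" where
  "label l = apsnd (\<lambda>p. ladder_index l p div l)"

lemma fst_label [simp]: "fst (label l x) = fst x"
  by (simp add: label_def)

lemma label_eq_iff:
  assumes "is_partition D" "is_partition E" "i < l"
    and "x \<in> signed_boxes l i D" "y \<in> signed_boxes l i E"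
  shows "label l x = label l y \<longleftrightarrow>
    fst x = fst y \<and> ladder_index l (snd x) = ladder_index l (snd y)"
  using signed_boxes_same_residue[OF assms]
  by (auto simp: label_def prod_eq_iff) (metis div_mult_mod_eq)

lemma code_label_eq_iff: "code (label l x) = code (label l y) \<longleftrightarrow> label l x = label l y"
  using inj_code by (simp add: inj_eq)

text \<open>Different ladders of one residue have different labels, so only signs on a common ladder
  need the separate condition that no minus precedes a plus.\<close>

lemma code_label_mono:
  assumes "is_partition D" "i < l" "x \<in> signed_boxes l i D" "y \<in> signed_boxes l i D"
    and "ladder_index l (snd x) \<le> ladder_index l (snd y)"
    and "ladder_index l (snd x) = ladder_index l (snd y) \<Longrightarrow> fst x = Minus \<Longrightarrow> fst y = Plus \<Longrightarrow> False"
  shows "code (label l x) \<le> code (label l y)"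
proof (cases "ladder_index l (snd x) = ladder_index l (snd y)")
  case True
  then show ?thesis
    using assms(6) sign.exhaust[of "fst y"] by (auto simp: code_def label_def)
next
  case False
  have "ladder_index l (snd x) div l \<noteq> ladder_index l (snd y) div l"
    using False signed_boxes_same_residue[OF assms(1,1,2,3,4)] by (metis div_mult_mod_eq)
  then have "ladder_index l (snd x) div l < ladder_index l (snd y) div l"
    using assms(5) div_le_mono le_neq_implies_less by blast
  then show ?thesis
    by (auto simp: code_def label_def)
qed

text \<open>The order of boxes with the same sign and ladder is left open. Hence both signatures can
  be such words, although one reads each ladder upwards and the other downwards.\<close>

definition word_of :: "nat \<Rightarrow> nat \<Rightarrow> diagram \<Rightarrow> (sign \<times> pos) list \<Rightarrow> bool" where
  "word_of l i D w \<longleftrightarrow> distinct w \<and> set w = signed_boxes l i D \<and>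
     sorted (map (code \<circ> label l) w)"

lemma count_mset_map:
  assumes "distinct w"
  shows "count (mset (map f w)) y = card {x \<in> set w. f x = y}"
  using assms
proof (induction w)
  case (Cons x w)
  have "{z \<in> set (x # w). f z = y} =
    (if f x = y then insert x {z \<in> set w. f z = y} else {z \<in> set w. f z = y})"
    by auto
  then show ?case
    using Cons by simp
qed simp

lemma count_label_word:
  assumes "word_of l i D w"
  shows "count (mset (map (label l) w)) (s, j) =
    card {p. (s, p) \<in> signed_boxes l i D \<and> ladder_index l p div l = j}"
proof -
  have "count (mset (map (label l) w)) (s, j) = card {x \<in> set w. label l x = (s, j)}"
    using assms by (intro count_mset_map) (simp add: word_of_def)
  also have "{x \<in> set w. label l x = (s, j)} =
    Pair s ` {p. (s, p) \<in> signed_boxes l i D \<and> ladder_index l p div l = j}"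
    using assms by (auto simp: word_of_def label_def)
  finally show ?thesis
    by (simp add: card_image inj_on_def)
qed

text \<open>Within the residue, label \<open>j\<close> stands for the ladder of index
  \<open>l * j + r\<close>. Consecutive labels are thus \<open>l\<close> apart, which is the
  distance in \<open>corner_count_balance\<close>, and equal ladder counts yield the assumptions of
  \<open>reduce_sorted_cong\<close>.\<close>

lemma labelled_reduce_eq:
  assumes "2 \<le> l" "i < l" "is_partition D" "is_partition E"
    and "\<And>k. card (D \<inter> Ladder l k) = card (E \<inter> Ladder l k)"
    and "word_of l i D v" "word_of l i E w"
  shows "map (label l) (reduce v) = map (label l) (reduce w)"
proof -
  obtain r where r: "r < l" "\<And>p. is_pos p \<Longrightarrow> residue l p = int i \<longleftrightarrow> ladder_index l p mod l = r"
    using residue_iff_ladder_index assms(2) by blast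
  have div_iff: "residue l p = int i \<and> ladder_index l p div l = j \<longleftrightarrow> ladder_index l p = l * j + r"
    if "is_pos p" for p j
    using r that by (metis div_mult_mod_eq div_mult_self4 mod_less mod_mult_self4 mult.commute
        add.commute div_less add_0 less_nat_zero_code)
  \<comment> \<open>The minuses labelled \<open>j\<close> are described through the next ladder, of
    index \<open>l * Suc j + r\<close>, which serves as \<open>k\<close> in
    \<open>corner_count_balance\<close>.\<close>
  have Plus: "count (mset (map (label l) u)) (Plus, j) =
      card {p \<in> Ladder l (l * j + r). outer_corner F p}"
    and Minus: "count (mset (map (label l) u)) (Minus, j) =
      card {q. is_pos q \<and> inner_corner F q \<and> ladder_index l q + l = l * Suc j + r}"
    if F: "is_partition F" and u: "word_of l i F u" for F u j
  proof -
    have "{p. (Plus, p) \<in> signed_boxes l i F \<and> ladder_index l p div l = j} =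
      {p \<in> Ladder l (l * j + r). outer_corner F p}"
      using div_iff signed_boxes_pos[OF F] by (fastforce simp: Ladder_def signed_boxes_iff)
    then show "count (mset (map (label l) u)) (Plus, j) =
        card {p \<in> Ladder l (l * j + r). outer_corner F p}"
      by (simp only: count_label_word[OF u])
    have "{p. (Minus, p) \<in> signed_boxes l i F \<and> ladder_index l p div l = j} =
      {q. is_pos q \<and> inner_corner F q \<and> ladder_index l q + l = l * Suc j + r}"
      using div_iff signed_boxes_pos[OF F] by (fastforce simp: signed_boxes_iff)
    then show "count (mset (map (label l) u)) (Minus, j) =
        card {q. is_pos q \<and> inner_corner F q \<and> ladder_index l q + l = l * Suc j + r}"
      by (simp only: count_label_word[OF u])
  qed
  have "reduce (map (label l) v) = reduce (map (label l) w)"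
  proof (rule reduce_sorted_cong)
    show "sorted (map code (map (label l) v))" "sorted (map code (map (label l) w))"
      using assms(6,7) by (simp_all add: word_of_def)
    \<comment> \<open>As \<open>r < l\<close>, no index plus \<open>l\<close> equals
      \<open>r\<close>: the inner corner terms vanish for the first ladder of the residue.\<close>
    have "card {p \<in> Ladder l r. outer_corner D p} = card {p \<in> Ladder l r. outer_corner E p}"
      using corner_count_balance[OF assms(1,3,4,5), of r] r(1) by simp
    then show "count (mset (map (label l) v)) (Plus, 0) = count (mset (map (label l) w)) (Plus, 0)"
      using Plus[of _ _ 0] assms(3,4,6,7) by simp
    show "count (mset (map (label l) v)) (Plus, Suc j) + count (mset (map (label l) w)) (Minus, j) =
      count (mset (map (label l) w)) (Plus, Suc j) + count (mset (map (label l) v)) (Minus, j)" for j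
      using corner_count_balance[OF assms(1,3,4,5), of "l * Suc j + r"] assms(3,4,6,7)
      by (simp only: Plus Minus)
  qed
  then show ?thesis
    by (simp add: label_def reduce_map)
qed

section \<open>Ladder order and row order\<close>

text \<open>Here \<open>(a, b)\<close> ends its row and \<open>(c, d)\<close> ends its column, so the box \<open>(a, d)\<close> has arm \<open>b - d\<close>
  and leg \<open>c - a\<close>; equality of the two ladders means that the leg plus one is \<open>l - 1\<close> times the
  arm.\<close>

definition locked :: "nat \<Rightarrow> diagram \<Rightarrow> bool" where
  "locked l D \<longleftrightarrow> (\<forall>a b c d. (a, b) \<in> D \<and> (a, Suc b) \<notin> D \<and> (c, d) \<in> D \<and> (Suc c, d) \<notin> D \<and>
     a \<le> c \<longrightarrow> ladder_index l (a, b) \<noteq> ladder_index l (Suc c, d))"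

lemma lockedD:
  "locked l D \<Longrightarrow> (a, b) \<in> D \<Longrightarrow> (a, Suc b) \<notin> D \<Longrightarrow> (c, d) \<in> D \<Longrightarrow> (Suc c, d) \<notin> D \<Longrightarrow> a \<le> c \<Longrightarrow>
    ladder_index l (a, b) = ladder_index l (Suc c, d) \<Longrightarrow> False"
  unfolding locked_def by blast

lemma signed_boxes_ladder_row_inj:
  assumes "2 \<le> l" "is_partition D" "x \<in> signed_boxes l i D" "y \<in> signed_boxes l i D"
    and "ladder_index l (snd x) = ladder_index l (snd y)" "fst (snd x) = fst (snd y)"
  shows "x = y"
proof -
  have "snd x = snd y"
    using inj_onD[OF inj_on_fst_Ladder[OF assms(1)] assms(6)] signed_boxes_pos[OF assms(2)] assms(3-5)
    by (simp add: Ladder_def)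
  moreover have "fst x = fst y"
    using assms(3,4) \<open>snd x = snd y\<close>
    by (auto elim!: signed_boxes_cases simp: outer_corner_def inner_corner_def)
  ultimately show ?thesis
    by (simp add: prod_eq_iff)
qed

text \<open>The only corners in a row are the box at its end and the position right after it. Their
  indices differ by \<open>l - 1\<close>, which \<open>l\<close> does not divide, so their residues
  differ.\<close>

lemma signed_boxes_row_unique:
  assumes "2 \<le> l" "i < l" "is_partition D" "x \<in> signed_boxes l i D" "y \<in> signed_boxes l i D"
    and "fst (snd x) = fst (snd y)"
  shows "x = y"
proof -
  have less: False
    if xy: "x \<in> signed_boxes l i D" "y \<in> signed_boxes l i D" "snd x = (a, b)" "snd y = (a, d)"
      and "b < d" for x y a b d
  proof -
    have pos: "1 \<le> a" "1 \<le> b"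
      using signed_boxes_pos[OF assms(3) xy(1)] xy(3) by (auto simp: is_pos_def)
    have res: "d \<noteq> Suc b"
    proof
      assume "d = Suc b"
      then have "ladder_index l (a, b) mod l = (ladder_index l (a, b) + (l - 1)) mod l"
        using signed_boxes_same_residue[OF assms(3,3,2) xy(1,2)] xy(3,4) pos
        by (simp add: ladder_index_Suc)
      then have "l dvd l - 1"
        by (metis add_diff_cancel_left' le_add1 mod_eq_dvd_iff_nat)
      then show False
        using assms(1) by (auto dest: dvd_imp_le)
    qed
    have y: "(a, d - 1) \<in> D"
      using xy(2)
    proof (cases rule: signed_boxes_cases)
      case (Plus p)
      then show ?thesis
        using xy(4) \<open>b < d\<close> pos by (auto simp: outer_corner_iff[OF assms(3)])
    next
      case (Minus p)
      then show ?thesis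
        using xy(4) \<open>b < d\<close> pos is_partition_downward[OF assms(3), of a d a "d - 1"]
        by (auto simp: inner_corner_iff[OF assms(3)])
    qed
    show False
      using xy(1)
    proof (cases rule: signed_boxes_cases)
      case (Plus p)
      then show ?thesis
        using xy(3) \<open>b < d\<close> pos is_partition_downward[OF assms(3) y, of a b]
        by (auto simp: outer_corner_iff[OF assms(3)])
    next
      case (Minus p)
      then show ?thesis
        using xy(3) \<open>b < d\<close> pos res is_partition_downward[OF assms(3) y, of a "Suc b"]
        by (auto simp: inner_corner_iff[OF assms(3)])
    qed
  qed
  obtain a b d where ab: "snd x = (a, b)" "snd y = (a, d)"
    using assms(6) by (metis prod.collapse)
  then have "b = d"
    using less[OF assms(4,5)] less[OF assms(5,4)] by (metis nat_neq_iff)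
  then show ?thesis
    using ab signed_boxes_ladder_row_inj[OF assms(1,3-5)] by simp
qed

lemma ladder_signature_props:
  assumes "2 \<le> l" "is_partition D"
  shows "set (ladder_signature l i D) = signed_boxes l i D" "distinct (ladder_signature l i D)"
    "sorted (map (\<lambda>x. (ladder_index l (snd x), fst (snd x))) (ladder_signature l i D))"
proof -
  have "inj_on (\<lambda>x. (ladder_index l (snd x), fst (snd x))) (signed_boxes l i D)"
    using signed_boxes_ladder_row_inj[OF assms] by (auto intro!: inj_onI)
  note * = sorted_key_list_of_set_props[OF this finite_signed_boxes[OF assms(2)]]
  show "set (ladder_signature l i D) = signed_boxes l i D" "distinct (ladder_signature l i D)"
    "sorted (map (\<lambda>x. (ladder_index l (snd x), fst (snd x))) (ladder_signature l i D))"
    unfolding ladder_signature_def by (fact *)+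
qed

lemma signature_props:
  assumes "2 \<le> l" "i < l" "is_partition D"
  shows "set (signature l i D) = signed_boxes l i D" "distinct (signature l i D)"
    "sorted (map (\<lambda>x. - int (fst (snd x))) (signature l i D))"
proof -
  have "inj_on (\<lambda>x. - int (fst (snd x))) (signed_boxes l i D)"
    using signed_boxes_row_unique[OF assms] by (auto intro!: inj_onI)
  note * = sorted_key_list_of_set_props[OF this finite_signed_boxes[OF assms(3)]]
  show "set (signature l i D) = signed_boxes l i D" "distinct (signature l i D)"
    "sorted (map (\<lambda>x. - int (fst (snd x))) (signature l i D))"
    unfolding signature_def by (fact *)+
qed

lemma sorted_map_mono:
  assumes "sorted (map f xs)"
    and "\<And>x y. x \<in> set xs \<Longrightarrow> y \<in> set xs \<Longrightarrow> f x \<le> f y \<Longrightarrow> g x \<le> g y"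
  shows "sorted (map g xs)"
  using assms(1) unfolding sorted_map by (rule sorted_wrt_mono_rel[rotated]) (rule assms(2))

text \<open>In a locked partition the pluses lie above the minuses on every ladder, because a
  removable box above an addable one on the same ladder is excluded.\<close>

lemma word_of_ladder_signature:
  assumes "2 \<le> l" "i < l" "is_partition D" "locked l D"
  shows "word_of l i D (ladder_signature l i D)"
proof -
  have "code (label l x) \<le> code (label l y)"
    if xy: "x \<in> signed_boxes l i D" "y \<in> signed_boxes l i D"
      and le: "(ladder_index l (snd x), fst (snd x)) \<le> (ladder_index l (snd y), fst (snd y))"
    for x y
  proof (rule code_label_mono[OF assms(3,2) xy])
    show "ladder_index l (snd x) \<le> ladder_index l (snd y)"
      using le by (auto simp: less_eq_prod_def)
    assume eq: "ladder_index l (snd x) = ladder_index l (snd y)" "fst x = Minus" "fst y = Plus"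
    obtain a b c d where p: "x = (Minus, (a, b))" "y = (Plus, (c, d))"
      using eq by (metis prod.collapse)
    have row: "a \<le> c"
      using le eq(1) p by (auto simp: less_eq_prod_def)
    moreover have "a \<noteq> c"
      using signed_boxes_ladder_row_inj[OF assms(1,3) xy] eq p by auto
    ultimately obtain c' where c': "c = Suc c'" "a \<le> c'"
      by (cases c) auto
    have x: "(a, b) \<in> D" "(a, Suc b) \<notin> D"
      using xy(1) p by (simp_all add: signed_boxes_iff inner_corner_iff[OF assms(3)])
    then have "1 \<le> a"
      using is_partition_pos[OF assms(3), of "(a, b)"] by (simp add: is_pos_def)
    then have "(c, d) \<notin> D" "(c', d) \<in> D"
      using xy(2) p c' by (auto simp: signed_boxes_iff outer_corner_iff[OF assms(3)])
    then show False
      using lockedD[OF assms(4) x, of c' d] c' eq(1) p by simp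
  qed
  then have "sorted (map (code \<circ> label l) (ladder_signature l i D))"
    using ladder_signature_props[OF assms(1,3), of i]
    by (intro sorted_map_mono[OF ladder_signature_props(3)[OF assms(1,3)]]) simp
  then show ?thesis
    using ladder_signature_props[OF assms(1,3)] by (simp add: word_of_def)
qed

text \<open>Going up \<open>l - 1\<close> rows and right one column stays on the ladder; here this
  is done \<open>m\<close> times.\<close>

lemma top_closed_slide:
  assumes "top_closed l E" "(c + (l - 1) * m, b) \<in> E" "1 \<le> c"
  shows "(c, b + m) \<in> E"
proof -
  have pos: "is_pos (c + (l - 1) * m, b)"
    using assms top_closed_pos by blast
  then have pos': "is_pos (c, b + m)"
    using assms(3) by (simp add: is_pos_def)
  have "ladder_index l (c, b + m) = ladder_index l (c + (l - 1) * m, b)"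
    unfolding ladder_index_eq_iff[OF pos' pos] by (simp add: add_mult_distrib2)
  then show ?thesis
    using top_closedD[OF assms(1,2) pos'] by simp
qed

text \<open>In a diagram whose boxes sit at the top of their ladders, reading the signs from bottom to
  top never moves to a ladder further left: otherwise sliding up the box above the lower sign would
  produce a box below the upper sign.\<close>

lemma word_of_signature:
  assumes "2 \<le> l" "i < l" "is_partition E" "top_closed l E"
  shows "word_of l i E (signature l i E)"
proof -
  have "code (label l x) \<le> code (label l y)"
    if xy: "x \<in> signed_boxes l i E" "y \<in> signed_boxes l i E"
      and le: "- int (fst (snd x)) \<le> - int (fst (snd y))"
    for x y
  proof (cases "fst (snd x) = fst (snd y)")
    case True
    then show ?thesis
      using signed_boxes_row_unique[OF assms(1-3) xy] by simp
  next
    case False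
    obtain a b c d where p: "snd x = (a, b)" "snd y = (c, d)"
      by (metis prod.collapse)
    have "c < a"
      using le False p by simp
    have pos: "1 \<le> a" "1 \<le> b" "1 \<le> c" "1 \<le> d"
      using signed_boxes_pos[OF assms(3)] xy p by (fastforce simp: is_pos_def)+
    have above: "(a - 1, b) \<in> E"
      using xy(1)
    proof (cases rule: signed_boxes_cases)
      case (Plus q)
      then show ?thesis
        using p \<open>c < a\<close> pos by (auto simp: outer_corner_iff[OF assms(3)])
    next
      case (Minus q)
      then show ?thesis
        using p \<open>c < a\<close> pos is_partition_downward[OF assms(3), of a b "a - 1" b]
        by (auto simp: inner_corner_iff[OF assms(3)])
    qed
    then have left: "(c, b) \<in> E"
      using is_partition_downward[OF assms(3) above, of c b] \<open>c < a\<close> pos by simp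
    have y: "b \<le> d \<and> (Suc c, d) \<notin> E"
      using xy(2)
    proof (cases rule: signed_boxes_cases)
      case (Plus q)
      then have "(c, d) \<notin> E"
        using p by (simp add: outer_corner_def)
      then show ?thesis
        using is_partition_downward[OF assms(3) left, of c d] pos
          is_partition_downward[OF assms(3), of "Suc c" d c d] by force
    next
      case (Minus q)
      then have "(c, Suc d) \<notin> E" "(Suc c, d) \<notin> E"
        using p by (simp_all add: inner_corner_iff[OF assms(3)])
      then show ?thesis
        using is_partition_downward[OF assms(3) left, of c "Suc d"] pos by force
    qed
    show ?thesis
    proof (rule code_label_mono[OF assms(3,2) xy])
      show "ladder_index l (snd x) \<le> ladder_index l (snd y)"
      proof (rule ccontr)
        assume "\<not> ?thesis"
        then have less: "ladder_index l (c, d) < ladder_index l (a, b)"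
          using p by simp
        \<comment> \<open>Equal residues make the gap a multiple of \<open>l\<close>, hence at least
          \<open>l\<close>. This is enough for the column of \<open>(a - 1, b)\<close> to contain a
          box that slides up to \<open>(Suc c, d)\<close>.\<close>
        then have "l dvd ladder_index l (a, b) - ladder_index l (c, d)"
          using signed_boxes_same_residue[OF assms(3,3,2) xy] p
          by (metis less_imp_le mod_eq_dvd_iff_nat snd_conv)
        then have "ladder_index l (c, d) + l \<le> ladder_index l (a, b)"
          using less dvd_imp_le[of l "ladder_index l (a, b) - ladder_index l (c, d)"] by linarith
        then have "c + (l - 1) * d + l \<le> a + (l - 1) * b"
          using ladder_index_add[of a b l] ladder_index_add[of c d l] pos by (simp add: is_pos_def)
        moreover obtain m where m: "d = b + m"
          using y le_Suc_ex by blast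
        ultimately have "Suc c + (l - 1) * m \<le> a - 1"
          using assms(1) by (simp add: add_mult_distrib2)
        then have "(Suc c + (l - 1) * m, b) \<in> E"
          using is_partition_downward[OF assms(3) above] pos by simp
        then show False
          using top_closed_slide[OF assms(4), of "Suc c" m b] y m by simp
      qed
      assume eq: "ladder_index l (snd x) = ladder_index l (snd y)" "fst x = Minus" "fst y = Plus"
      then have "(a, b) \<in> E" "(c, d) \<notin> E"
        using xy p by (auto elim!: signed_boxes_cases simp: outer_corner_def inner_corner_def)
      then show False
        using top_closedD[OF assms(4), of "(a, b)" "(c, d)"] eq(1) p \<open>c < a\<close> pos
        by (simp add: is_pos_def)
    qed
  qed
  then have "sorted (map (code \<circ> label l) (signature l i E))"
    using signature_props[OF assms(1-3)]
    by (intro sorted_map_mono[OF signature_props(3)[OF assms(1-3)]]) simp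
  then show ?thesis
    using signature_props[OF assms(1-3)] by (simp add: word_of_def)
qed

section \<open>Neighbours of the uncancelled signs\<close>

definition plus_boxes :: "(sign \<times> 'a) list \<Rightarrow> (sign \<times> 'a) list" where
  "plus_boxes w = filter (\<lambda>x. fst x = Plus) (reduce w)"

definition minus_boxes :: "(sign \<times> 'a) list \<Rightarrow> (sign \<times> 'a) list" where
  "minus_boxes w = filter (\<lambda>x. fst x = Minus) (reduce w)"

text \<open>A letter \<open>q\<close> right of the last remaining plus is at or beyond the letter
  directly after that plus, which is a minus and serves as \<open>v\<close>. Two keys are carried
  along: \<open>f\<close> will be the coarse code of sign and ladder, \<open>key\<close> the exact
  reading order.\<close>

lemma last_plus_boxes:
  fixes key :: "sign \<times> 'a \<Rightarrow> 'b :: linorder" and f :: "sign \<times> 'a \<Rightarrow> 'c :: linorder"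
  assumes "plus_boxes w \<noteq> []"
  shows "last (plus_boxes w) \<in> set w" "fst (last (plus_boxes w)) = Plus"
    "sorted (map f w) \<Longrightarrow> sorted (map key w) \<Longrightarrow> q \<in> set w \<Longrightarrow>
      key q \<le> key (last (plus_boxes w)) \<or>
      (\<exists>v\<in>set w. fst v = Minus \<and> f (last (plus_boxes w)) \<le> f v \<and> f v \<le> f q \<and>
        key (last (plus_boxes w)) \<le> key v)"
proof -
  define z where "z = last (plus_boxes w)"
  obtain us vs where w: "w = us @ z # vs" "vs = [] \<or> fst (hd vs) = Minus"
    using last_plus_followed_by_minus assms unfolding z_def plus_boxes_def by blast
  then have "z \<in> set w"
    by simp
  then show "last (plus_boxes w) \<in> set w"
    by (simp only: z_def)
  show "fst (last (plus_boxes w)) = Plus"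
    using last_in_set[OF assms] by (simp add: plus_boxes_def)
  assume sorted: "sorted (map f w)" "sorted (map key w)" and q: "q \<in> set w"
  have "key q \<le> key z \<or> (\<exists>v\<in>set w. fst v = Minus \<and> f z \<le> f v \<and> f v \<le> f q \<and> key z \<le> key v)"
  proof (cases "q \<in> set us \<or> q = z")
    case True
    then show ?thesis
      using sorted w by (auto simp: sorted_append)
  next
    case False
    then have "q \<in> set vs"
      using q w by auto
    then obtain v vs' where "vs = v # vs'"
      by (cases vs) auto
    then show ?thesis
      using sorted w \<open>q \<in> set vs\<close> by (intro disjI2 bexI[of _ v]) (auto simp: sorted_append)
  qed
  then show "key q \<le> key (last (plus_boxes w)) \<or>
      (\<exists>v\<in>set w. fst v = Minus \<and> f (last (plus_boxes w)) \<le> f v \<and> f v \<le> f q \<and>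
        key (last (plus_boxes w)) \<le> key v)"
    by (simp only: z_def)
qed

lemma hd_minus_boxes:
  fixes key :: "sign \<times> 'a \<Rightarrow> 'b :: linorder" and f :: "sign \<times> 'a \<Rightarrow> 'c :: linorder"
  assumes "minus_boxes w \<noteq> []"
  shows "hd (minus_boxes w) \<in> set w" "fst (hd (minus_boxes w)) = Minus"
    "sorted (map f w) \<Longrightarrow> sorted (map key w) \<Longrightarrow> q \<in> set w \<Longrightarrow>
      key (hd (minus_boxes w)) \<le> key q \<or>
      (\<exists>v\<in>set w. fst v = Plus \<and> f q \<le> f v \<and> f v \<le> f (hd (minus_boxes w)))"
proof -
  define z where "z = hd (minus_boxes w)"
  obtain us vs where w: "w = us @ z # vs" "us = [] \<or> fst (last us) = Plus"
    using first_minus_preceded_by_plus assms unfolding z_def minus_boxes_def by blast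
  then have "z \<in> set w"
    by simp
  then show "hd (minus_boxes w) \<in> set w"
    by (simp only: z_def)
  show "fst (hd (minus_boxes w)) = Minus"
    using hd_in_set[OF assms] by (simp add: minus_boxes_def)
  assume sorted: "sorted (map f w)" "sorted (map key w)" and q: "q \<in> set w"
  have "key z \<le> key q \<or> (\<exists>v\<in>set w. fst v = Plus \<and> f q \<le> f v \<and> f v \<le> f z)"
  proof (cases "q \<in> set vs \<or> q = z")
    case True
    then show ?thesis
      using sorted w by (auto simp: sorted_append)
  next
    case False
    then have "q \<in> set us"
      using q w by auto
    then obtain v us' where "us = us' @ [v]"
      by (cases us rule: rev_cases) auto
    then show ?thesis
      using sorted w \<open>q \<in> set us\<close> by (intro disjI2 bexI[of _ v]) (auto simp: sorted_append)
  qed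
  then show "key (hd (minus_boxes w)) \<le> key q \<or>
      (\<exists>v\<in>set w. fst v = Plus \<and> f q \<le> f v \<and> f v \<le> f (hd (minus_boxes w)))"
    by (simp only: z_def)
qed

section \<open>The crystal operators\<close>

lemma label_eq_boxes:
  assumes "is_partition D" "is_partition E" "i < l"
    and "x \<in> signed_boxes l i D" "y \<in> signed_boxes l i E" "label l x = label l y"
  shows "fst x = fst y" "ladder_index l (snd x) = ladder_index l (snd y)"
  using label_eq_iff[OF assms(1-5)] assms(6) by auto

lemma code_label_sign_neq [simp]: "code (label l (Minus, p)) \<noteq> code (label l (Plus, q))"
  by (metis code_label_eq_iff fst_conv fst_label sign.distinct(1))

text \<open>Both neighbours of \<open>(c, d)\<close> come from the box \<open>(a - 1, b)\<close>:
  the upper one lies higher on its ladder, and sliding it up to column \<open>d - 1\<close> ends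
  \<open>l - 2\<close> rows below row \<open>c\<close>, which gives the left one.\<close>

lemma outer_corner_above:
  assumes "2 \<le> l" "is_partition E" "top_closed l E" "outer_corner E (a, b)"
    and "is_pos (c, d)" "(c, d) \<notin> E" "c < a" "ladder_index l (c, d) = ladder_index l (a, b)"
  shows "outer_corner E (c, d)"
proof -
  have pos: "1 \<le> c" "1 \<le> d"
    using assms(5) by (auto simp: is_pos_def)
  have ab: "1 \<le> b" "(a - 1, b) \<in> E"
    using assms(4,7) pos by (auto simp: outer_corner_iff[OF assms(2)])
  have sum: "c + (l - 1) * d = a + (l - 1) * b"
    using assms(8) ladder_index_eq_iff[OF assms(5), of "(a, b)" l] ab assms(7)
    by (simp add: is_pos_def)
  have "b < d"
  proof (rule ccontr)
    assume "\<not> b < d"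
    then have "(l - 1) * d \<le> (l - 1) * b"
      by simp
    then show False
      using sum assms(7) by linarith
  qed
  then obtain m where m: "d = Suc (b + m)"
    using less_imp_Suc_add by auto
  have a: "a - 1 = (c + (l - 2)) + (l - 1) * m"
  proof -
    have "(l - 1) * d = (l - 1) + (l - 1) * b + (l - 1) * m"
      by (simp add: m add_mult_distrib2)
    then show ?thesis
      using sum assms(1) by linarith
  qed
  have "(c + (l - 2), b + m) \<in> E"
    using top_closed_slide[OF assms(3), of "c + (l - 2)" m b] ab(2) pos a by simp
  then have "(c, d - 1) \<in> E"
    using is_partition_downward[OF assms(2), of "c + (l - 2)" "b + m" c "b + m"] m pos ab by simp
  moreover have "c = 1 \<or> (c - 1, d) \<in> E"
  proof (cases "c = 1")
    case False
    then have pos': "is_pos (c - 1, d)" "is_pos (a - 1, b)"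
      using pos assms(7) ab by (auto simp: is_pos_def)
    have "ladder_index l (c - 1, d) = ladder_index l (a - 1, b)"
      unfolding ladder_index_eq_iff[OF pos'] using sum pos assms(7) by simp
    then show ?thesis
      using top_closedD[OF assms(3) ab(2) pos'(1)] assms(7) by simp
  qed simp
  ultimately show ?thesis
    using assms(6) pos by (simp add: outer_corner_iff[OF assms(2)])
qed

text \<open>A box below or to the right of \<open>(c, d)\<close> would force, higher on its own
  ladder, a box below or to the right of \<open>(a, b)\<close>.\<close>

lemma inner_corner_below:
  assumes "is_partition E" "top_closed l E" "inner_corner E (a, b)"
    and "(c, d) \<in> E" "a < c" "ladder_index l (c, d) = ladder_index l (a, b)"
  shows "inner_corner E (c, d)"
proof -
  have ab: "(Suc a, b) \<notin> E" "(a, Suc b) \<notin> E" "is_pos (a, b)"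
    using assms(3) is_partition_pos[OF assms(1), of "(a, b)"]
    by (simp_all add: inner_corner_iff[OF assms(1)])
  have cd: "1 \<le> d"
    using assms(4) is_partition_pos[OF assms(1), of "(c, d)"] by (simp add: is_pos_def)
  have "(Suc c, d) \<notin> E"
    using top_closedD[OF assms(2), of "(Suc c, d)" "(Suc a, b)"] ab assms(5,6)
    by (auto simp: ladder_index_Suc is_pos_def)
  moreover have "(c, Suc d) \<notin> E"
    using top_closedD[OF assms(2), of "(c, Suc d)" "(a, Suc b)"] ab cd assms(5,6)
    by (auto simp: ladder_index_Suc is_pos_def)
  ultimately show ?thesis
    using assms(4) by (simp add: inner_corner_iff[OF assms(1)])
qed

lemma card_insert_Ladder:
  assumes "2 \<le> l" "p \<notin> D" "is_pos p"
  shows "card (insert p D \<inter> Ladder l k) =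
    card (D \<inter> Ladder l k) + (if ladder_index l p = k then 1 else 0)"
proof -
  have "insert p D \<inter> Ladder l k =
    (if ladder_index l p = k then insert p (D \<inter> Ladder l k) else D \<inter> Ladder l k)"
    using assms(3) by (auto simp: Ladder_def)
  then show ?thesis
    using assms(2) finite_Ladder[OF assms(1)] by simp
qed

lemma f_hat_eq: "f_hat l i D = (let ps = plus_boxes (ladder_signature l i D)
    in if ps = [] then None else Some (insert (snd (last ps)) D))"
  by (simp add: f_hat_def add_by_word_def reduced_word_eq_reduce plus_boxes_def)

lemma f_tilde_eq: "f_tilde l i D = (let ps = plus_boxes (signature l i D)
    in if ps = [] then None else Some (insert (snd (last ps)) D))"
  by (simp add: f_tilde_def add_by_word_def reduced_word_eq_reduce plus_boxes_def)

lemma e_hat_eq: "e_hat l i D = (let ms = minus_boxes (ladder_signature l i D)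
    in if ms = [] then None else Some (D - {snd (hd ms)}))"
  by (simp add: e_hat_def remove_by_word_def reduced_word_eq_reduce minus_boxes_def)

lemma e_tilde_eq: "e_tilde l i D = (let ms = minus_boxes (signature l i D)
    in if ms = [] then None else Some (D - {snd (hd ms)}))"
  by (simp add: e_tilde_def remove_by_word_def reduced_word_eq_reduce minus_boxes_def)

section \<open>Commutation with regularization, and its invariant\<close>

context
  fixes l i :: nat and D :: diagram
  assumes l: "2 \<le> l" and i: "i < l"
    and D: "is_partition D" "locked l D" "is_partition (regularization l D)"
begin

abbreviation (input) E where "E \<equiv> regularization l D"
abbreviation (input) v where "v \<equiv> ladder_signature l i D"
abbreviation (input) w where "w \<equiv> signature l i E"

lemma labelled_boxes_eq:
  "map (label l) (plus_boxes v) = map (label l) (plus_boxes w)"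
  "map (label l) (minus_boxes v) = map (label l) (minus_boxes w)"
proof -
  have "map (label l) (reduce v) = map (label l) (reduce w)"
    using labelled_reduce_eq[OF l i D(1,3) card_regularization[OF l, symmetric]
        word_of_ladder_signature[OF l i D(1,2)]
        word_of_signature[OF l i D(3) top_closed_regularization[OF l]]] .
  then have "filter (\<lambda>x. fst x = s) (map (label l) (reduce v)) =
      filter (\<lambda>x. fst x = s) (map (label l) (reduce w))" for s
    by simp
  then show "map (label l) (plus_boxes v) = map (label l) (plus_boxes w)"
    "map (label l) (minus_boxes v) = map (label l) (minus_boxes w)"
    by (simp_all add: plus_boxes_def minus_boxes_def filter_map comp_def)
qed

lemma sorted_code_words: "sorted (map (code \<circ> label l) v)" "sorted (map (code \<circ> label l) w)"
  using word_of_ladder_signature[OF l i D(1,2)]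
    word_of_signature[OF l i D(3) top_closed_regularization[OF l]]
  by (simp_all add: word_of_def)

text \<open>By \<open>labelled_boxes_eq\<close> both operators add a box on the same ladder. The box
  added to \<open>E\<close> takes the highest free position there, so the result is top-closed and
  is the regularization by uniqueness.\<close>

lemma regularization_f_hat: "map_option (regularization l) (f_hat l i D) = f_tilde l i E"
proof (cases "plus_boxes v = []")
  case True
  then have "plus_boxes w = []"
    using labelled_boxes_eq(1) by auto
  then show ?thesis
    using True by (simp add: f_hat_eq f_tilde_eq)
next
  case False
  then have ne: "plus_boxes w \<noteq> []"
    using labelled_boxes_eq(1) by auto
  note sigD = ladder_signature_props[OF l D(1), of i] and sigE = signature_props[OF l i D(3)]
  define z where "z = snd (last (plus_boxes v))"
  define y where "y = snd (last (plus_boxes w))"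
  have last: "last (plus_boxes v) = (Plus, z)" "last (plus_boxes w) = (Plus, y)"
    using last_plus_boxes(2)[OF False] last_plus_boxes(2)[OF ne]
    by (simp_all add: z_def y_def prod_eq_iff)
  have zy: "(Plus, z) \<in> signed_boxes l i D" "(Plus, y) \<in> signed_boxes l i E"
    using last_plus_boxes(1)[OF False] last_plus_boxes(1)[OF ne] sigD(1) sigE(1) last by simp_all
  have "label l (Plus, z) = label l (Plus, y)"
    using False ne last labelled_boxes_eq(1) by (metis last_map)
  then have idx: "ladder_index l z = ladder_index l y"
    using label_eq_boxes[OF D(1,3) i zy] by simp
  have z: "z \<notin> D" "is_pos z"
    using zy(1) signed_boxes_pos[OF D(1) zy(1)] by (simp_all add: signed_boxes_iff outer_corner_def)
  have y: "outer_corner E y" "y \<notin> E" "is_pos y"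
    using zy(2) signed_boxes_pos[OF D(3) zy(2)] by (simp_all add: signed_boxes_iff outer_corner_def)
  \<comment> \<open>A higher free position \<open>q\<close> would be a plus on the same ladder, read
    after \<open>y\<close>. A minus would then have its code between two equal plus codes.\<close>
  have top: "q \<in> E" if q: "is_pos q" "ladder_index l q = ladder_index l y" "fst q < fst y" for q
  proof (rule ccontr)
    assume "q \<notin> E"
    then have "outer_corner E q"
      using outer_corner_above[OF l D(3) top_closed_regularization[OF l], of "fst y" "snd y"
          "fst q" "snd q"] y q by simp
    moreover have "residue l q = int i"
      using zy(2) residue_cong[OF i q(1) y(3)] q(2) by (simp add: signed_boxes_iff)
    ultimately have "(Plus, q) \<in> signed_boxes l i E"
      by (simp add: signed_boxes_iff)
    moreover have "label l (Plus, q) = label l (Plus, y)"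
      using q(2) by (simp add: label_def)
    ultimately show False
      using last_plus_boxes(3)[OF ne sorted_code_words(2) sigE(3), of "(Plus, q)"] q(3)
      unfolding sigE(1) last by auto
  qed
  have "top_closed l (insert y E)"
    unfolding top_closed_def
  proof (intro ballI conjI allI impI)
    fix p q
    assume p: "p \<in> insert y E"
      and q: "is_pos q \<and> ladder_index l q = ladder_index l p \<and> fst q \<le> fst p"
    show "q \<in> insert y E"
    proof (cases "p = y")
      case True
      then show ?thesis
        using q top[of q] y(3) inj_onD[OF inj_on_fst_Ladder[OF l], of q y "ladder_index l y"]
        by (auto simp: Ladder_def le_less)
    next
      case False
      then show ?thesis
        using p q top_closedD[OF top_closed_regularization[OF l]] by blast
    qed
  qed (use y(3) is_partition_pos[OF D(3)] in blast)
  moreover have "card (insert y E \<inter> Ladder l k) = card (insert z D \<inter> Ladder l k)" for k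
    using idx z y by (simp add: card_insert_Ladder[OF l] card_regularization[OF l])
  ultimately have "regularization l (insert z D) = insert y E"
    by (rule regularization_unique[OF l])
  then show ?thesis
    using False ne last by (simp add: f_hat_eq f_tilde_eq)
qed

text \<open>As for adding: both removed boxes lie on the same ladder, and the one removed from
  \<open>E\<close> is the lowest box there.\<close>

lemma regularization_e_hat: "map_option (regularization l) (e_hat l i D) = e_tilde l i E"
proof (cases "minus_boxes v = []")
  case True
  then have "minus_boxes w = []"
    using labelled_boxes_eq(2) by auto
  then show ?thesis
    using True by (simp add: e_hat_eq e_tilde_eq)
next
  case False
  then have ne: "minus_boxes w \<noteq> []"
    using labelled_boxes_eq(2) by auto
  note sigD = ladder_signature_props[OF l D(1), of i] and sigE = signature_props[OF l i D(3)]
  define z where "z = snd (hd (minus_boxes v))"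
  define y where "y = snd (hd (minus_boxes w))"
  have hd: "hd (minus_boxes v) = (Minus, z)" "hd (minus_boxes w) = (Minus, y)"
    using hd_minus_boxes(2)[OF False] hd_minus_boxes(2)[OF ne]
    by (simp_all add: z_def y_def prod_eq_iff)
  have zy: "(Minus, z) \<in> signed_boxes l i D" "(Minus, y) \<in> signed_boxes l i E"
    using hd_minus_boxes(1)[OF False] hd_minus_boxes(1)[OF ne] sigD(1) sigE(1) hd by simp_all
  have "label l (Minus, z) = label l (Minus, y)"
    using False ne hd labelled_boxes_eq(2) by (metis hd_map)
  then have idx: "ladder_index l z = ladder_index l y"
    using label_eq_boxes[OF D(1,3) i zy] by simp
  have z: "z \<in> D" "is_pos z"
    using zy(1) signed_boxes_pos[OF D(1) zy(1)] by (simp_all add: signed_boxes_iff inner_corner_def)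
  have y: "inner_corner E y" "y \<in> E" "is_pos y"
    using zy(2) signed_boxes_pos[OF D(3) zy(2)] by (simp_all add: signed_boxes_iff inner_corner_def)
  \<comment> \<open>A lower box \<open>q\<close> would be a minus on the same ladder, read before
    \<open>y\<close>, and a plus would have its code between two equal minus codes.\<close>
  have bottom: "fst q \<le> fst y" if q: "q \<in> E" "ladder_index l q = ladder_index l y" for q
  proof (rule ccontr)
    assume less: "\<not> fst q \<le> fst y"
    then have "inner_corner E q"
      using inner_corner_below[OF D(3) top_closed_regularization[OF l], of "fst y" "snd y"
          "fst q" "snd q"] y q by simp
    moreover have "residue l q = int i"
      using zy(2) residue_cong[OF i is_partition_pos[OF D(3) q(1)] y(3)] q(2)
      by (simp add: signed_boxes_iff)
    ultimately have "(Minus, q) \<in> signed_boxes l i E"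
      by (simp add: signed_boxes_iff)
    moreover have "label l (Minus, q) = label l (Minus, y)"
      using q(2) by (simp add: label_def)
    ultimately show False
      using hd_minus_boxes(3)[OF ne sorted_code_words(2) sigE(3), of "(Minus, q)"] less
      unfolding sigE(1) hd by (auto dest: order_antisym)
  qed
  have "top_closed l (E - {y})"
    unfolding top_closed_def
  proof (intro ballI conjI allI impI)
    fix p q
    assume p: "p \<in> E - {y}"
      and q: "is_pos q \<and> ladder_index l q = ladder_index l p \<and> fst q \<le> fst p"
    have "p = y" if "q = y"
      using that p q bottom[of p] y(3) is_partition_pos[OF D(3), of p]
        inj_onD[OF inj_on_fst_Ladder[OF l], of p y "ladder_index l y"]
      by (auto simp: Ladder_def)
    moreover have "q \<in> E"
      using p q top_closedD[OF top_closed_regularization[OF l]] by blast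
    ultimately show "q \<in> E - {y}"
      using p by blast
  qed (use is_partition_pos[OF D(3)] in blast)
  moreover have "card ((E - {y}) \<inter> Ladder l k) = card ((D - {z}) \<inter> Ladder l k)" for k
    using card_insert_Ladder[OF l, of z "D - {z}" k] card_insert_Ladder[OF l, of y "E - {y}" k]
      idx z y card_regularization[OF l, of D k] by (simp add: insert_absorb)
  ultimately have "regularization l (D - {z}) = E - {y}"
    by (rule regularization_unique[OF l])
  then show ?thesis
    using False ne hd by (simp add: e_hat_eq e_tilde_eq)
qed

text \<open>A violation of \<open>locked\<close> created by the new box has that box as the end of
  its row or as the end of its column. Each case leads either to a violation already present in
  \<open>D\<close> or to a plus that contradicts the choice of the new box.\<close>

lemma f_hat_invariant:
  assumes "f_hat l i D = Some D'"
  shows "is_partition D'" "locked l D'" "is_partition (regularization l D')"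
proof -
  have ne: "plus_boxes v \<noteq> []"
    using assms by (auto simp: f_hat_eq)
  note sig = ladder_signature_props[OF l D(1), of i]
  obtain a0 b0 where last: "last (plus_boxes v) = (Plus, (a0, b0))"
    using last_plus_boxes(2)[OF ne] by (metis prod.collapse)
  have D': "D' = insert (a0, b0) D"
    using assms ne last by (simp add: f_hat_eq)
  have signed: "(Plus, (a0, b0)) \<in> signed_boxes l i D"
    using last_plus_boxes(1)[OF ne] sig(1) last by simp
  then have outer: "outer_corner D (a0, b0)"
    by (simp add: signed_boxes_iff)
  then show "is_partition D'"
    by (simp add: D' outer_corner_def)
  have z: "(a0, b0) \<notin> D" "1 \<le> a0" "1 \<le> b0" "a0 \<noteq> 1 \<Longrightarrow> (a0 - 1, b0) \<in> D"
    "b0 \<noteq> 1 \<Longrightarrow> (a0, b0 - 1) \<in> D"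
    using outer by (auto simp: outer_corner_iff[OF D(1)])
  \<comment> \<open>A plus \<open>q\<close> read after the new box is separated from it by the minus
    that directly follows the new box.\<close>
  have next_sign: "ladder_index l q < ladder_index l (a0, b0) \<or>
      ladder_index l q = ladder_index l (a0, b0) \<and> fst q \<le> a0 \<or>
      (\<exists>x\<in>signed_boxes l i D. fst x = Minus \<and> code (label l (Plus, (a0, b0))) \<le> code (label l x) \<and>
        code (label l x) \<le> code (label l (Plus, q)) \<and>
        (ladder_index l (a0, b0), a0) \<le> (ladder_index l (snd x), fst (snd x)))"
    if "(Plus, q) \<in> signed_boxes l i D" for q
    using last_plus_boxes(3)[OF ne sorted_code_words(1) sig(3), of "(Plus, q)"] that
    unfolding sig(1) last by (auto simp: less_eq_prod_def)
  have res: "residue l q = int i" if "is_pos q" "ladder_index l q mod l = ladder_index l (a0, b0) mod l"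
    for q
    using residue_cong[OF i that(1), of "(a0, b0)"] that(2) signed z(2,3)
    by (simp add: signed_boxes_iff is_pos_def)
  show "locked l D'"
    unfolding locked_def
  proof (intro allI impI notI, elim conjE)
    fix a b c d
    assume ab: "(a, b) \<in> D'" "(a, Suc b) \<notin> D'" and cd: "(c, d) \<in> D'" "(Suc c, d) \<notin> D'"
      and "a \<le> c" and eq: "ladder_index l (a, b) = ladder_index l (Suc c, d)"
    have pos: "1 \<le> a" "1 \<le> b" "1 \<le> c" "1 \<le> d"
      using ab(1) cd(1) is_partition_pos[OF \<open>is_partition D'\<close>] by (fastforce simp: is_pos_def)+
    consider "(a, b) = (a0, b0)" | "(a, b) \<noteq> (a0, b0)" "(c, d) = (a0, b0)"
      | "(a, b) \<noteq> (a0, b0)" "(c, d) \<noteq> (a0, b0)"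
      by blast
    then show False
    proof cases
      case 1
      then have "(c, d) \<noteq> (a0, b0)"
        using eq by (auto simp: ladder_index_Suc)
      then have cd': "(c, d) \<in> D" "(Suc c, d) \<notin> D"
        using cd by (auto simp: D')
      \<comment> \<open>The new box ends its row. If \<open>(Suc c, d)\<close> is addable, it is a
        lower plus on the ladder of the new box, with no minus in between. Otherwise moving both
        boxes one column left gives a violation in \<open>D\<close>.\<close>
      show False
      proof (cases "outer_corner D (Suc c, d)")
        case True
        then have "(Plus, (Suc c, d)) \<in> signed_boxes l i D"
          using res[of "(Suc c, d)"] eq 1 pos by (simp add: signed_boxes_iff is_pos_def)
        moreover have "label l (Plus, (Suc c, d)) = label l (Plus, (a0, b0))"
          using eq 1 by (simp add: label_def)
        ultimately show False
          using next_sign[of "(Suc c, d)"] eq 1 \<open>a \<le> c\<close> by auto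
      next
        case False
        then obtain d' where d': "d = Suc d'" "1 \<le> d'" "(Suc c, d') \<notin> D"
          using cd' pos by (cases d) (auto simp: outer_corner_iff[OF D(1)])
        have "a + (l - 1) * b = Suc c + (l - 1) * d"
          using eq ladder_index_eq_iff[of "(a, b)" "(Suc c, d)" l] pos by (simp add: is_pos_def)
        then have "(l - 1) * d < (l - 1) * b"
          using \<open>a \<le> c\<close> by linarith
        then obtain b' where b': "b = Suc b'" "1 \<le> b'"
          using d' by (cases b) auto
        have "(a, b') \<in> D" "(a, Suc b') \<notin> D"
          using z 1 b' by auto
        moreover have "(c, d') \<in> D"
          using is_partition_downward[OF D(1) cd'(1), of c d'] d' pos by simp
        moreover have "ladder_index l (a, b') = ladder_index l (Suc c, d')"
          using eq b' d' by (simp add: ladder_index_Suc(2))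
        ultimately show False
          using lockedD[OF D(2)] d'(3) \<open>a \<le> c\<close> by blast
      qed
    next
      case 2
      then have ab': "(a, b) \<in> D" "(a, Suc b) \<notin> D"
        using ab by (auto simp: D')
      have eq': "ladder_index l (a, b) = Suc (ladder_index l (a0, b0))"
        using eq 2 by (simp add: ladder_index_Suc)
      have "a \<noteq> a0"
      proof
        assume "a = a0"
        then have "a + (l - 1) * b = Suc a + (l - 1) * b0"
          using eq 2 ladder_index_eq_iff[of "(a, b)" "(Suc a0, b0)" l] pos
          by (simp add: is_pos_def)
        then have "(l - 1) * b0 < (l - 1) * b"
          by linarith
        then show False
          using is_partition_downward[OF D(1) ab'(1), of a0 b0] z \<open>a = a0\<close> by simp
      qed
      then have "a < a0"
        using 2 \<open>a \<le> c\<close> by simp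
      \<comment> \<open>The new box ends its column. If \<open>(a, Suc b)\<close> were not addable,
        moving both boxes one row up would give a violation in \<open>D\<close>.\<close>
      have "(a - 1, Suc b) \<in> D" if "a \<noteq> 1"
      proof (rule ccontr)
        assume "(a - 1, Suc b) \<notin> D"
        moreover have "(a - 1, b) \<in> D"
          using is_partition_downward[OF D(1) ab'(1), of "a - 1" b] that pos by simp
        moreover have "(a0 - 1, b0) \<in> D" "(Suc (a0 - 1), b0) \<notin> D"
          using z \<open>a < a0\<close> pos by simp_all
        moreover have "ladder_index l (a - 1, b) = ladder_index l (Suc (a0 - 1), b0)"
          using eq' ladder_index_Suc(1)[of l "a - 1" b] pos z(2) by simp
        moreover have "a - 1 \<le> a0 - 1"
          using \<open>a < a0\<close> by simp
        ultimately show False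
          using lockedD[OF D(2), of "a - 1" b "a0 - 1" b0] that pos by simp
      qed
      then have "outer_corner D (a, Suc b)"
        using ab' pos by (auto simp: outer_corner_iff[OF D(1)])
      \<comment> \<open>The plus at \<open>(a, Suc b)\<close> lies on the next ladder of the
        residue, so the minus following the new box must lie on the new box's ladder, at or below
        it. That minus and \<open>(a, b)\<close> violate \<open>locked\<close> in
        \<open>D\<close>.\<close>
      moreover have idx: "ladder_index l (a, Suc b) = ladder_index l (a0, b0) + l"
        using eq' pos l by (simp add: ladder_index_Suc(2))
      ultimately have w: "(Plus, (a, Suc b)) \<in> signed_boxes l i D"
        using res[of "(a, Suc b)"] pos by (simp add: signed_boxes_iff is_pos_def)
      then obtain x where x: "x \<in> signed_boxes l i D" "fst x = Minus"
        "code (label l (Plus, (a0, b0))) \<le> code (label l x)"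
        "code (label l x) \<le> code (label l (Plus, (a, Suc b)))"
        "(ladder_index l (a0, b0), a0) \<le> (ladder_index l (snd x), fst (snd x))"
        using next_sign[of "(a, Suc b)"] idx l by auto
      obtain e f where ef: "x = (Minus, (e, f))"
        using x(2) by (metis prod.collapse)
      have "ladder_index l (a, Suc b) div l = Suc (ladder_index l (a0, b0) div l)"
        using idx l by (simp add: div_add_self2)
      then have "ladder_index l (e, f) div l = ladder_index l (a0, b0) div l"
        using x(3,4) ef by (simp add: code_def label_def)
      then have idx': "ladder_index l (e, f) = ladder_index l (a0, b0)"
        using signed_boxes_same_residue[OF D(1,1) i x(1) signed] ef
        by (metis div_mult_mod_eq snd_conv)
      then have "a0 \<le> e"
        using x(5) ef by (simp add: less_eq_prod_def)
      have "(e, f) \<in> D" "(Suc e, f) \<notin> D"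
        using x(1) ef by (simp_all add: signed_boxes_iff inner_corner_iff[OF D(1)])
      moreover have "ladder_index l (a, b) = ladder_index l (Suc e, f)"
        using eq' idx' by (simp add: ladder_index_Suc)
      ultimately show False
        using lockedD[OF D(2) ab'] \<open>a < a0\<close> \<open>a0 \<le> e\<close> by force
    next
      case 3
      then show False
        using ab cd eq \<open>a \<le> c\<close> lockedD[OF D(2)] by (auto simp: D')
    qed
  qed
  \<comment> \<open>By commutation the new regularization arises from \<open>E\<close> by adding an
    addable box, hence is again a partition.\<close>
  have "f_tilde l i E = Some (regularization l D')"
    using regularization_f_hat assms by simp
  then have ne: "plus_boxes w \<noteq> []" and "regularization l D' = insert (snd (last (plus_boxes w))) E"
    by (auto simp: f_tilde_eq Let_def split: if_splits)
  moreover have "last (plus_boxes w) \<in> signed_boxes l i E" "fst (last (plus_boxes w)) = Plus"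
    using last_plus_boxes(1,2)[OF ne] signature_props(1)[OF l i D(3)] by simp_all
  ultimately show "is_partition (regularization l D')"
    by (auto elim!: signed_boxes_cases simp: outer_corner_def)
qed

end

lemma ladder_crystal_invariant:
  assumes "2 \<le> l" "D \<in> ladder_crystal l"
  shows "is_partition D \<and> locked l D \<and> is_partition (regularization l D)"
  using assms(2)
proof induction
  case empty
  have "regularization l {} = {}"
    by (simp add: regularization_def)
  then show ?case
    by (simp add: is_partition_def locked_def)
next
  case (step D i D')
  then show ?case
    using f_hat_invariant[OF assms(1), of i D D'] by blast
qed

theorem theorem3p9p1p7:
  fixes l i :: nat
  assumes "3 \<le> l" and "i < l"
  shows "(\<forall>D \<in> ladder_crystal l.
            map_option (regularization l) (f_hat l i D) = f_tilde l i (regularization l D)) \<and>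
         (\<forall>D \<in> ladder_crystal l.
            map_option (regularization l) (e_hat l i D) = e_tilde l i (regularization l D))"
proof -
  have "2 \<le> l"
    using assms(1) by simp
  then show ?thesis
    using ladder_crystal_invariant regularization_f_hat regularization_e_hat assms(2) by simp
qed

end
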